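(* Let $\Bbbk$ be a field, $\mathbf{P}$ a finite poset, $A=\Bbbk[\mathbf{P}]$, and $\xi$ a rank compression system for $A$. Let $M\in\operatorname{mod}A$ and let $I$ be an interval of $\mathbf{P}$. Then $$\operatorname{rank}^\xi_I\delta^\xi(M)=\operatorname{rank}^\xi_IM .$$ In particular, for any segment $[x,y]$ of $\mathbf{P}$, $$\operatorname{rank}^\xi_{[x,y]}\delta^\xi(M)=\operatorname{rank}_{[x,y]}M,\qquad \underline{\dim}\,\delta^\xi(M)=\underline{\dim}\,M .$$
   Context: Incidence category and modules: $\Bbbk[\mathbf{P}]$ is the $\Bbbk$-linear category with object set $\mathbf{P}$, $\Bbbk[\mathbf{P}](x,y)=\Bbbk p_{y,x}$ (one-dimensional) if $x\le y$ and $0$ otherwise, $p_{z,y}p_{y,x}=p_{z,x}$, identities $p_{x,x}$. An order-preserving map $f$ induces a linear functor $\Bbbk[f]$ by $x\mapsto f(x)$, $p_{y,x}\mapsto p_{f(y),f(x)}$. $\operatorname{mod}\Bbbk[\mathbf{P}]$ is the category of $\Bbbk$-linear functors $\Bbbk[\mathbf{P}]\to\operatorname{mod}\Bbbk$ (finite-dimensional vector spaces). For $x\le y$, $\operatorname{rank}_{[x,y]}M:=\operatorname{rank}M(p_{y,x})$; the dimension vector is $\underline{\dim}\,M\colon x\mapsto\dim M(x)$. Intervals: a nonempty full subposet $I\subseteq\mathbf{P}$ is an interval if it is connected (any two elements are joined by a finite sequence in $I$ whose consecutive elements are comparable) and convex. $\mathbb{I}$ is the set of all intervals, ordered by inclusion;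 $\operatorname{sc}(I)$, $\operatorname{sk}(I)$ are the sets of minimal and maximal elements. A segment is $[x,y]=\{z\mid x\le z\le y\}$ with $x\le y$. The interval module $V_I$ has $V_I(x)=\Bbbk$ for $x\in I$, $0$ otherwise, and $V_I(p_{y,x})=\mathrm{id}_\Bbbk$ if $x\le y$ are both in $I$, $0$ otherwise. A rank compression system $\xi$ is a family of order-preserving maps $\xi_I\colon I^\xi\to\mathbf{P}$ ($I\in\mathbb{I}$) from connected (nonempty) finite posets $I^\xi$ such that for all $I$: (1) the image of $\xi_I$ is contained in $I$; (2) it contains $\operatorname{sc}(I)\cup\operatorname{sk}(I)$; (3) whenever $I=[x,y]$ is a segment, there are $x'\le y'$ in $I^\xi$ with $\xi_I(x')=x$, $\xi_I(y')=y$. Put $R_I(M)=M\circ\Bbbk[\xi_I]\in\operatorname{mod}\Bbbk[I^\xi]$. The module $R_I(V_I)$ is indecomposable; $\operatorname{rank}^\xi_IM=c^\xi_M(I)$ is its multiplicity as a direct summand in the indecomposable decomposition of $R_I(M)$. Interval replacement: $\operatorname{Cov}(I)=\{L\in\mathbb{I}\mid I<L,\ \text{no interval lies strictly between }I\text{ and }L\}$. For nonempty $S\subseteq\operatorname{Cov}(I)$, $\bigvee S$ is the least upper bound of $S$ in $\mathbb{I}$ (it exists), $\bigvee\emptyset:=I$. Put $\delta^\xi_M(I)=\sum_{S\subseteq\operatorname{Cov}(I)}(-1)^{|S|}c^\xi_M(\bigvee S)$, $\delta^\xi(M)_+=\bigoplus_{\delta^\xi_M(I)>0}V_I^{\delta^\xi_M(I)}$,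 $\delta^\xi(M)_-=\bigoplus_{\delta^\xi_M(I)<0}V_I^{-\delta^\xi_M(I)}$, and $\delta^\xi(M)=[\![\delta^\xi(M)_+]\!]-[\![\delta^\xi(M)_-]\!]$ in the split Grothendieck group of $\operatorname{mod}A$. Then $\operatorname{rank}^\xi_I\delta^\xi(M):=\operatorname{rank}^\xi_I\delta^\xi(M)_+-\operatorname{rank}^\xi_I\delta^\xi(M)_-$ and $\underline{\dim}\,\delta^\xi(M):=\underline{\dim}\,\delta^\xi(M)_+-\underline{\dim}\,\delta^\xi(M)_-$. *)

theory Defs
  imports Complex_Main "HOL-Library.FuncSet" "HOL-Library.Function_Algebras"
begin

text \<open>A poset is given by its order relation \<open>r\<close> (a reflexive, antisymmetric and transitive
  relation on \<open>Field r\<close>); its underlying set is \<open>Field r\<close>, and \<open>(x, y) \<in> r\<close> means \<open>x \<le> y\<close>.\<close>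

definition finite_poset :: "'x rel \<Rightarrow> bool" where
  "finite_poset r \<longleftrightarrow> Partial_order r \<and> finite (Field r)"


subsection \<open>Modules over the incidence category\<close>

text \<open>The morphism \<open>c \<cdot> p\<^bsub>y,x\<^esub>\<close> of the incidence category is encoded by its coefficient \<open>c\<close>.
  Composition of morphisms is then multiplication of coefficients and the identities are \<open>1\<close>.\<close>

definition inc_hom :: "'x rel \<Rightarrow> 'x \<Rightarrow> 'x \<Rightarrow> 'k::field set" where
  "inc_hom r x y = (if (x, y) \<in> r then UNIV else {0})"

text \<open>The spaces \<open>M(x)\<close> are subspaces \<open>obj M x\<close> of a common vector space, the type \<open>'v\<close> with
  scalar multiplication \<open>scl M\<close>. The map \<open>M(c \<cdot> p\<^bsub>y,x\<^esub>)\<close> is \<open>act M x y c\<close> (source before target);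
  its values outside \<open>obj M x\<close> are irrelevant.\<close>

record ('x, 'k, 'v) rep =
  scl :: "'k \<Rightarrow> 'v \<Rightarrow> 'v"
  obj :: "'x \<Rightarrow> 'v set"
  act :: "'x \<Rightarrow> 'x \<Rightarrow> 'k \<Rightarrow> 'v \<Rightarrow> 'v"

definition linear_between ::
  "('k::field \<Rightarrow> 'v::ab_group_add \<Rightarrow> 'v) \<Rightarrow> ('k \<Rightarrow> 'w::ab_group_add \<Rightarrow> 'w) \<Rightarrow>
    'v set \<Rightarrow> 'w set \<Rightarrow> ('v \<Rightarrow> 'w) \<Rightarrow> bool" where
  "linear_between s t V W f \<longleftrightarrow>
    f \<in> V \<rightarrow> W \<and>
    (\<forall>u\<in>V. \<forall>v\<in>V. f (u + v) = f u + f v) \<and>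
    (\<forall>a. \<forall>v\<in>V. f (s a v) = t a (f v))"

definition is_mod :: "'x rel \<Rightarrow> ('x, 'k::field, 'v::ab_group_add) rep \<Rightarrow> bool" where
  "is_mod r M \<longleftrightarrow>
    vector_space (scl M) \<and>
    (\<forall>x\<in>Field r. module.subspace (scl M) (obj M x) \<and>
       (\<exists>B. finite B \<and> module.span (scl M) B = obj M x)) \<and>
    (\<forall>x\<in>Field r. \<forall>y\<in>Field r. \<forall>c\<in>inc_hom r x y.
       linear_between (scl M) (scl M) (obj M x) (obj M y) (act M x y c)) \<and>
    (\<forall>x\<in>Field r. \<forall>v\<in>obj M x. act M x x 1 v = v) \<and>
    (\<forall>x\<in>Field r. \<forall>y\<in>Field r. \<forall>z\<in>Field r. \<forall>c\<in>inc_hom r x y. \<forall>d\<in>inc_hom r y z. \<forall>v\<in>obj M x.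
       act M x z (d * c) v = act M y z d (act M x y c v)) \<and>
    (\<forall>x\<in>Field r. \<forall>y\<in>Field r. \<forall>c\<in>inc_hom r x y. \<forall>d\<in>inc_hom r x y. \<forall>v\<in>obj M x.
       act M x y (c + d) v = act M x y c v + act M x y d v) \<and>
    (\<forall>x\<in>Field r. \<forall>y\<in>Field r. \<forall>a. \<forall>c\<in>inc_hom r x y. \<forall>v\<in>obj M x.
       act M x y (a * c) v = scl M a (act M x y c v))"

definition mod_iso ::
  "'x rel \<Rightarrow> ('x, 'k::field, 'v::ab_group_add) rep \<Rightarrow> ('x, 'k, 'w::ab_group_add) rep \<Rightarrow> bool" where
  "mod_iso r M N \<longleftrightarrow>
    (\<exists>f. (\<forall>x\<in>Field r. linear_between (scl M) (scl N) (obj M x) (obj N x) (f x) \<and>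
            bij_betw (f x) (obj M x) (obj N x)) \<and>
         (\<forall>x\<in>Field r. \<forall>y\<in>Field r. \<forall>c\<in>inc_hom r x y. \<forall>v\<in>obj M x.
            f y (act M x y c v) = act N x y c (f x v)))"

definition mod_dim :: "('x, 'k::field, 'v::ab_group_add) rep \<Rightarrow> 'x \<Rightarrow> nat" where
  "mod_dim M x = vector_space.dim (scl M) (obj M x)"

text \<open>The rank of \<open>M(p\<^bsub>y,x\<^esub>)\<close>, for \<open>x \<le> y\<close>.\<close>

definition seg_rank :: "('x, 'k::field, 'v::ab_group_add) rep \<Rightarrow> 'x \<Rightarrow> 'x \<Rightarrow> nat" where
  "seg_rank M x y = vector_space.dim (scl M) (act M x y 1 ` obj M x)"


subsection \<open>Direct sums and multiplicities\<close>

definition direct_sum ::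
  "'i set \<Rightarrow> ('i \<Rightarrow> ('x, 'k::field, 'v::ab_group_add) rep) \<Rightarrow> ('x, 'k, 'i \<Rightarrow> 'v) rep" where
  "direct_sum A F =
    \<lparr>scl = (\<lambda>a u i. scl (F i) a (u i)),
     obj = (\<lambda>x. {u. (\<forall>i\<in>A. u i \<in> obj (F i) x) \<and> (\<forall>i. i \<notin> A \<longrightarrow> u i = 0)}),
     act = (\<lambda>x y c u i. if i \<in> A then act (F i) x y c (u i) else 0)\<rparr>"

definition submod ::
  "'x rel \<Rightarrow> ('x, 'k::field, 'v::ab_group_add) rep \<Rightarrow> ('x \<Rightarrow> 'v set) \<Rightarrow> bool" where
  "submod r M U \<longleftrightarrow> (\<forall>x\<in>Field r. U x \<subseteq> obj M x) \<and> is_mod r (M\<lparr>obj := U\<rparr>)"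

definition zero_fam :: "'x rel \<Rightarrow> ('x \<Rightarrow> 'v::ab_group_add set) \<Rightarrow> bool" where
  "zero_fam r U \<longleftrightarrow> (\<forall>x\<in>Field r. U x = {0})"

definition indecomposable :: "'x rel \<Rightarrow> ('x, 'k::field, 'v::ab_group_add) rep \<Rightarrow> bool" where
  "indecomposable r M \<longleftrightarrow>
    is_mod r M \<and> \<not> zero_fam r (obj M) \<and>
    (\<forall>U W. submod r M U \<and> submod r M W \<and>
       (\<forall>x\<in>Field r. U x \<inter> W x = {0} \<and> (\<forall>v\<in>obj M x. \<exists>u\<in>U x. \<exists>w\<in>W x. v = u + w)) \<longrightarrow>
       zero_fam r U \<or> zero_fam r W)"

text \<open>\<open>M\<close> is the internal direct sum of its indecomposable submodules \<open>D 0, \<dots>, D (n - 1)\<close>.\<close>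

definition indec_decomp ::
  "'x rel \<Rightarrow> ('x, 'k::field, 'v::ab_group_add) rep \<Rightarrow> nat \<Rightarrow> (nat \<Rightarrow> 'x \<Rightarrow> 'v set) \<Rightarrow> bool" where
  "indec_decomp r M n D \<longleftrightarrow>
    (\<forall>i<n. submod r M (D i) \<and> indecomposable r (M\<lparr>obj := D i\<rparr>)) \<and>
    (\<forall>x\<in>Field r. \<forall>v\<in>obj M x. \<exists>!u. u \<in> (\<Pi>\<^sub>E i\<in>{..<n}. D i x) \<and> v = (\<Sum>i<n. u i))"

text \<open>The number of summands isomorphic to \<open>X\<close> in an indecomposable decomposition of \<open>M\<close>. By the
  Krull--Schmidt theorem it does not depend on the decomposition.\<close>

definition multiplicity ::
  "'x rel \<Rightarrow> ('x, 'k::field, 'w::ab_group_add) rep \<Rightarrow> ('x, 'k, 'v::ab_group_add) rep \<Rightarrow> nat" where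
  "multiplicity r X M =
    (THE m. \<exists>n D. indec_decomp r M n D \<and> m = card {i. i < n \<and> mod_iso r (M\<lparr>obj := D i\<rparr>) X})"


subsection \<open>Intervals\<close>

definition conn_in :: "'x rel \<Rightarrow> 'x set \<Rightarrow> bool" where
  "conn_in r I \<longleftrightarrow> (\<forall>x\<in>I. \<forall>y\<in>I. (x, y) \<in> ((r \<union> r\<inverse>) \<inter> I \<times> I)\<^sup>*)"

definition convex_in :: "'x rel \<Rightarrow> 'x set \<Rightarrow> bool" where
  "convex_in r I \<longleftrightarrow> (\<forall>x\<in>I. \<forall>y\<in>I. \<forall>z. (x, z) \<in> r \<and> (z, y) \<in> r \<longrightarrow> z \<in> I)"

definition intervals :: "'x rel \<Rightarrow> 'x set set" where
  "intervals r = {I. I \<subseteq> Field r \<and> I \<noteq> {} \<and> conn_in r I \<and> convex_in r I}"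

definition sc :: "'x rel \<Rightarrow> 'x set \<Rightarrow> 'x set" where
  "sc r I = {x\<in>I. \<forall>y\<in>I. (y, x) \<in> r \<longrightarrow> y = x}"

definition sk :: "'x rel \<Rightarrow> 'x set \<Rightarrow> 'x set" where
  "sk r I = {x\<in>I. \<forall>y\<in>I. (x, y) \<in> r \<longrightarrow> y = x}"

definition segment :: "'x rel \<Rightarrow> 'x \<Rightarrow> 'x \<Rightarrow> 'x set" where
  "segment r x y = {z. (x, z) \<in> r \<and> (z, y) \<in> r}"

text \<open>If \<open>x \<le> y\<close> fails then the only morphism from \<open>x\<close> to \<open>y\<close> is \<open>c = 0\<close>, so the order need not
  be mentioned in the action.\<close>

definition interval_module :: "'x set \<Rightarrow> ('x, 'k::field, 'k) rep" where
  "interval_module I =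
    \<lparr>scl = (*),
     obj = (\<lambda>x. if x \<in> I then UNIV else {0}),
     act = (\<lambda>x y c v. if x \<in> I \<and> y \<in> I then c * v else 0)\<rparr>"


subsection \<open>Rank compression systems\<close>

text \<open>\<open>shape \<xi> I\<close> is the order relation of the poset \<open>I\<^sup>\<xi>\<close>, and \<open>cmap \<xi> I\<close> is the map \<open>\<xi>\<^sub>I\<close>.\<close>

record ('p, 'q) compression =
  shape :: "'p set \<Rightarrow> 'q rel"
  cmap :: "'p set \<Rightarrow> 'q \<Rightarrow> 'p"

definition rank_compression_system :: "'p rel \<Rightarrow> ('p, 'q) compression \<Rightarrow> bool" where
  "rank_compression_system P \<xi> \<longleftrightarrow>
    (\<forall>I\<in>intervals P.
      finite_poset (shape \<xi> I) \<and> Field (shape \<xi> I) \<noteq> {} \<and>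
      conn_in (shape \<xi> I) (Field (shape \<xi> I)) \<and>
      (\<forall>(a, b)\<in>shape \<xi> I. (cmap \<xi> I a, cmap \<xi> I b) \<in> P) \<and>
      cmap \<xi> I ` Field (shape \<xi> I) \<subseteq> I \<and>
      sc P I \<union> sk P I \<subseteq> cmap \<xi> I ` Field (shape \<xi> I) \<and>
      (\<forall>x y. (x, y) \<in> P \<and> I = segment P x y \<longrightarrow>
         (\<exists>(x', y')\<in>shape \<xi> I. cmap \<xi> I x' = x \<and> cmap \<xi> I y' = y)))"

text \<open>Precomposition with the linear functor induced by an order-preserving map \<open>f\<close>. That functor
  sends \<open>c \<cdot> p\<^bsub>y,x\<^esub>\<close> to \<open>c \<cdot> p\<^bsub>f(y),f(x)\<^esub>\<close>, hence leaves coefficients unchanged.\<close>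

definition pullback :: "('q \<Rightarrow> 'p) \<Rightarrow> ('p, 'k, 'v) rep \<Rightarrow> ('q, 'k, 'v) rep" where
  "pullback f M =
    \<lparr>scl = scl M, obj = (\<lambda>a. obj M (f a)), act = (\<lambda>a b. act M (f a) (f b))\<rparr>"

definition R :: "('p, 'q) compression \<Rightarrow> 'p set \<Rightarrow> ('p, 'k, 'v) rep \<Rightarrow> ('q, 'k, 'v) rep" where
  "R \<xi> I M = pullback (cmap \<xi> I) M"

definition comp_rank ::
  "('p, 'q) compression \<Rightarrow> 'p set \<Rightarrow> ('p, 'k::field, 'v::ab_group_add) rep \<Rightarrow> nat" where
  "comp_rank \<xi> I M =
    multiplicity (shape \<xi> I) (R \<xi> I (interval_module I :: ('p, 'k, 'k) rep)) (R \<xi> I M)"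


subsection \<open>Interval replacement\<close>

definition Cov :: "'p rel \<Rightarrow> 'p set \<Rightarrow> 'p set set" where
  "Cov P I = {L\<in>intervals P. I \<subset> L \<and> \<not> (\<exists>K\<in>intervals P. I \<subset> K \<and> K \<subset> L)}"

definition is_join :: "'p rel \<Rightarrow> 'p set set \<Rightarrow> 'p set \<Rightarrow> bool" where
  "is_join P S J \<longleftrightarrow>
    J \<in> intervals P \<and> (\<forall>L\<in>S. L \<subseteq> J) \<and>
    (\<forall>K\<in>intervals P. (\<forall>L\<in>S. L \<subseteq> K) \<longrightarrow> J \<subseteq> K)"

definition join :: "'p rel \<Rightarrow> 'p set \<Rightarrow> 'p set set \<Rightarrow> 'p set" where
  "join P I S = (if S = {} then I else (THE J. is_join P S J))"

definition delta_mult ::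
  "'p rel \<Rightarrow> ('p, 'q) compression \<Rightarrow> ('p, 'k::field, 'v::ab_group_add) rep \<Rightarrow> 'p set \<Rightarrow> int" where
  "delta_mult P \<xi> M I =
    (\<Sum>S\<in>Pow (Cov P I). (- 1) ^ card S * int (comp_rank \<xi> (join P I S) M))"

text \<open>\<open>\<Oplus>\<^sub>I V\<^sub>I\<^bsup>m(I)\<^esup>\<close>, where a negative exponent counts as \<open>0\<close>.\<close>

definition interval_sum ::
  "'p rel \<Rightarrow> ('p set \<Rightarrow> int) \<Rightarrow> ('p, 'k::field, 'p set \<times> nat \<Rightarrow> 'k) rep" where
  "interval_sum P m =
    direct_sum {(I, i). I \<in> intervals P \<and> i < nat (m I)} (\<lambda>(I, i). interval_module I)"

text \<open>The element \<open>\<delta>\<^sup>\<xi>(M)\<close> of the split Grothendieck group is represented by the pair of its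
  positive and negative parts; rank and dimension of such a formal difference are the differences
  of those of the parts.\<close>

definition delta ::
  "'p rel \<Rightarrow> ('p, 'q) compression \<Rightarrow> ('p, 'k::field, 'v::ab_group_add) rep \<Rightarrow>
    ('p, 'k, 'p set \<times> nat \<Rightarrow> 'k) rep \<times> ('p, 'k, 'p set \<times> nat \<Rightarrow> 'k) rep" where
  "delta P \<xi> M =
    (interval_sum P (delta_mult P \<xi> M), interval_sum P (\<lambda>I. - delta_mult P \<xi> M I))"

definition virt_comp_rank ::
  "('p, 'q) compression \<Rightarrow> 'p set \<Rightarrow>
    ('p, 'k::field, 'v::ab_group_add) rep \<times> ('p, 'k, 'v) rep \<Rightarrow> int" where
  "virt_comp_rank \<xi> I N = int (comp_rank \<xi> I (fst N)) - int (comp_rank \<xi> I (snd N))"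

definition virt_dim ::
  "('p, 'k::field, 'v::ab_group_add) rep \<times> ('p, 'k, 'v) rep \<Rightarrow> 'p \<Rightarrow> int" where
  "virt_dim N x = int (mod_dim (fst N) x) - int (mod_dim (snd N) x)"

end

theory Submission
  imports Defs
begin

text \<open>Since \<open>\<xi>\<^sub>I\<close> has its image in \<open>I\<close>, the module \<open>R\<^sub>I(V\<^sub>I)\<close> is the constant module on the
  connected poset \<open>I\<^sup>\<xi>\<close>. Its multiplicity in \<open>N\<close> is the rank of the composition pairing between the
  homomorphisms from \<open>N\<close> to it (cosections) and those from it to \<open>N\<close> (sections); in particular it does
  not depend on the chosen decomposition. For \<open>N = R\<^sub>I(M)\<close> with \<open>I = [x, y]\<close> the pairing factors through
  \<open>M(x) \<rightarrow> M(y)\<close> and has the rank of this map. For \<open>N = R\<^sub>I(V\<^sub>J)\<close> the rank is \<open>1\<close> if \<open>I \<subseteq> J\<close> and \<open>0\<close>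
  otherwise, because a section vanishing at one point pairs to zero with everything and \<open>J\<close> contains \<open>I\<close> as
  soon as it contains \<open>sc(I)\<close> and \<open>sk(I)\<close>. So the rank of \<open>\<delta>(M)\<close> at \<open>I\<close> is the sum of the \<open>\<delta>\<^sub>M(J)\<close> over
  \<open>J \<supseteq> I\<close>, and the defining formula of \<open>\<delta>\<^sub>M\<close> inverts such sums. Dimensions are ranks at \<open>[x, x]\<close>.\<close>

section \<open>Modules over the incidence category\<close>

lemma inc_hom_zero: "0 \<in> inc_hom r x y"
  by (simp add: inc_hom_def)

lemma inc_hom_le: "(x, y) \<in> r \<Longrightarrow> c \<in> inc_hom r x y"
  by (simp add: inc_hom_def)

lemma inc_hom_cases:
  assumes "c \<in> inc_hom r x y"
  obtains "(x, y) \<in> r" | "c = 0"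
  using assms by (auto simp: inc_hom_def split: if_splits)

lemma is_modD:
  assumes "is_mod r M"
  shows "vector_space (scl M)"
    and "\<forall>x\<in>Field r. module.subspace (scl M) (obj M x) \<and>
       (\<exists>B. finite B \<and> module.span (scl M) B = obj M x)"
    and "\<forall>x\<in>Field r. \<forall>y\<in>Field r. \<forall>c\<in>inc_hom r x y.
       linear_between (scl M) (scl M) (obj M x) (obj M y) (act M x y c)"
    and "\<forall>x\<in>Field r. \<forall>v\<in>obj M x. act M x x 1 v = v"
    and "\<forall>x\<in>Field r. \<forall>y\<in>Field r. \<forall>z\<in>Field r. \<forall>c\<in>inc_hom r x y. \<forall>d\<in>inc_hom r y z. \<forall>v\<in>obj M x.
       act M x z (d * c) v = act M y z d (act M x y c v)"
    and "\<forall>x\<in>Field r. \<forall>y\<in>Field r. \<forall>c\<in>inc_hom r x y. \<forall>d\<in>inc_hom r x y. \<forall>v\<in>obj M x.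
       act M x y (c + d) v = act M x y c v + act M x y d v"
    and "\<forall>x\<in>Field r. \<forall>y\<in>Field r. \<forall>a. \<forall>c\<in>inc_hom r x y. \<forall>v\<in>obj M x.
       act M x y (a * c) v = scl M a (act M x y c v)"
  by (insert assms, unfold is_mod_def) (elim conjE; assumption)+

context
  fixes r :: "'x rel" and M :: "('x, 'k::field, 'v::ab_group_add) rep"
  assumes M: "is_mod r M"
begin

lemma mod_vector_space: "vector_space (scl M)"
  by (rule is_modD(1)[OF M])

lemma mod_subspace: "x \<in> Field r \<Longrightarrow> module.subspace (scl M) (obj M x)"
  using is_modD(2)[OF M] by blast

lemma mod_finite_span: "x \<in> Field r \<Longrightarrow> \<exists>B. finite B \<and> module.span (scl M) B = obj M x"
  using is_modD(2)[OF M] by blast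

lemma mod_act_linear:
  assumes "(x, y) \<in> r"
  shows "linear_between (scl M) (scl M) (obj M x) (obj M y) (act M x y c)"
proof -
  have "x \<in> Field r" "y \<in> Field r" using assms by (auto simp: Field_def)
  then show ?thesis
    using is_modD(3)[OF M] inc_hom_le[OF assms] by blast
qed

lemma mod_act_closed: "(x, y) \<in> r \<Longrightarrow> v \<in> obj M x \<Longrightarrow> act M x y c v \<in> obj M y"
  using mod_act_linear unfolding linear_between_def by blast

lemma mod_act_add:
  "(x, y) \<in> r \<Longrightarrow> u \<in> obj M x \<Longrightarrow> v \<in> obj M x \<Longrightarrow>
    act M x y c (u + v) = act M x y c u + act M x y c v"
  using mod_act_linear unfolding linear_between_def by blast

lemma mod_act_scl:
  "(x, y) \<in> r \<Longrightarrow> v \<in> obj M x \<Longrightarrow> act M x y c (scl M a v) = scl M a (act M x y c v)"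
  using mod_act_linear unfolding linear_between_def by blast

lemma mod_act_id: "x \<in> Field r \<Longrightarrow> v \<in> obj M x \<Longrightarrow> act M x x 1 v = v"
  using is_modD(4)[OF M] by blast

lemma mod_act_comp:
  assumes "(x, y) \<in> r" "(y, z) \<in> r" "v \<in> obj M x"
  shows "act M y z 1 (act M x y 1 v) = act M x z 1 v"
proof -
  have "x \<in> Field r" "y \<in> Field r" "z \<in> Field r" using assms by (auto simp: Field_def)
  moreover have "1 \<in> inc_hom r x y" "1 \<in> inc_hom r y z" using assms by (auto simp: inc_hom_le)
  ultimately have "act M x z (1 * 1) v = act M y z 1 (act M x y 1 v)"
    using is_modD(5)[OF M] assms(3) by blast
  then show ?thesis by simp
qed

text \<open>By linearity of the functor, coefficient 1 determines the action of all others. This is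
  why submodules, sections and cosections are tested on \<open>act M x y 1\<close> alone.\<close>

lemma mod_act_coeff:
  assumes "(x, y) \<in> r" "v \<in> obj M x"
  shows "act M x y c v = scl M c (act M x y 1 v)"
proof -
  have "x \<in> Field r" "y \<in> Field r" using assms by (auto simp: Field_def)
  then have "act M x y (c * 1) v = scl M c (act M x y 1 v)"
    using is_modD(7)[OF M] assms inc_hom_le[OF assms(1)] by blast
  then show ?thesis by simp
qed

text \<open>Where \<open>x \<le> y\<close> fails, coefficient 0 still encodes the zero morphism and
  its action occurs in the axioms; additivity in the coefficient forces it to vanish.\<close>

lemma mod_act_zero_coeff:
  assumes "x \<in> Field r" "y \<in> Field r" "v \<in> obj M x"
  shows "act M x y 0 v = 0"
proof -
  have "act M x y (0 + 0) v = act M x y 0 v + act M x y 0 v"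
    using is_modD(6)[OF M, rule_format, of x y 0 0 v] assms by (simp add: inc_hom_zero)
  then show ?thesis by simp
qed

lemma mod_zero_mem: "x \<in> Field r \<Longrightarrow> 0 \<in> obj M x"
proof -
  interpret vector_space "scl M" by (rule mod_vector_space)
  show "x \<in> Field r \<Longrightarrow> 0 \<in> obj M x" using mod_subspace subspace_0 by blast
qed

lemma mod_add_mem: "x \<in> Field r \<Longrightarrow> u \<in> obj M x \<Longrightarrow> v \<in> obj M x \<Longrightarrow> u + v \<in> obj M x"
proof -
  interpret vector_space "scl M" by (rule mod_vector_space)
  show "x \<in> Field r \<Longrightarrow> u \<in> obj M x \<Longrightarrow> v \<in> obj M x \<Longrightarrow> u + v \<in> obj M x"
    using mod_subspace subspace_add by blast
qed

lemma mod_diff_mem: "x \<in> Field r \<Longrightarrow> u \<in> obj M x \<Longrightarrow> v \<in> obj M x \<Longrightarrow> u - v \<in> obj M x"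
proof -
  interpret vector_space "scl M" by (rule mod_vector_space)
  show "x \<in> Field r \<Longrightarrow> u \<in> obj M x \<Longrightarrow> v \<in> obj M x \<Longrightarrow> u - v \<in> obj M x"
    using mod_subspace subspace_diff by blast
qed

lemma mod_scl_mem: "x \<in> Field r \<Longrightarrow> v \<in> obj M x \<Longrightarrow> scl M a v \<in> obj M x"
proof -
  interpret vector_space "scl M" by (rule mod_vector_space)
  show "x \<in> Field r \<Longrightarrow> v \<in> obj M x \<Longrightarrow> scl M a v \<in> obj M x"
    using mod_subspace subspace_scale by blast
qed

lemma mod_sum_mem:
  assumes "x \<in> Field r" and "\<And>i. i \<in> A \<Longrightarrow> u i \<in> obj M x"
  shows "sum u A \<in> obj M x"
proof -
  interpret vector_space "scl M" by (rule mod_vector_space)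
  show ?thesis using assms mod_subspace by (metis subspace_sum)
qed

end

section \<open>Finite-dimensional subspaces and submodules\<close>

lemma (in vector_space) finite_basis_of_subspace:
  assumes "subspace U" "U \<subseteq> span F" "finite F"
  obtains B where "B \<subseteq> U" "independent B" "finite B" "span B = U" "card B = dim U"
proof -
  obtain B where B: "B \<subseteq> U" "independent B" "U \<subseteq> span B" "card B = dim U"
    using basis_exists by metis
  \<comment> \<open>The ambient type may be infinite-dimensional; finiteness comes from
    \<open>F\<close>, since an independent subset of the span of a finite set is finite.\<close>
  moreover have "finite B"
    using independent_span_bound[OF assms(3) B(2)] B(1) assms(2) by blast
  moreover have "span B = U"
    using B assms(1) span_minimal by blast
  ultimately show thesis using that by blast
qed

lemma (in vector_space) dim_le_of_subset:
  assumes "subspace U" "subspace V" "U \<subseteq> V" "V \<subseteq> span F" "finite F"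
  shows "dim U \<le> dim V" and "U \<noteq> V \<Longrightarrow> dim U < dim V"
proof -
  obtain B where B: "B \<subseteq> U" "independent B" "finite B" "span B = U" "card B = dim U"
    using finite_basis_of_subspace[of U F] assms by blast
  obtain C where C: "B \<subseteq> C" "C \<subseteq> V" "independent C" "V \<subseteq> span C"
    using maximal_independent_subset_extend[of B V] B assms(3) by blast
  have fC: "finite C" using independent_span_bound[OF assms(5) C(3)] C(2) assms(4) by blast
  have dC: "card C = dim V" using basis_card_eq_dim[OF C(2,4,3)] by simp
  show "dim U \<le> dim V" using card_mono[OF fC C(1)] B dC by simp
  assume "U \<noteq> V"
  then have "B \<noteq> C" using B(4) C assms(2,3) span_minimal by blast
  then show "dim U < dim V" using psubset_card_mono[OF fC, of B] C(1) B(5) dC by auto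
qed

text \<open>For \<open>x \<le> y\<close> every coefficient acts as a multiple of
  \<open>act M x y 1\<close>, and otherwise the only coefficient is 0, which acts as zero; so
  invariance under coefficient 1 suffices. Finite spanning sets come from those of
  \<open>obj M x\<close>, and the remaining axioms are inherited.\<close>

lemma submodI:
  assumes M: "is_mod r M"
    and sub: "\<And>x. x \<in> Field r \<Longrightarrow> U x \<subseteq> obj M x"
    and subsp: "\<And>x. x \<in> Field r \<Longrightarrow> module.subspace (scl M) (U x)"
    and act: "\<And>x y v. (x, y) \<in> r \<Longrightarrow> v \<in> U x \<Longrightarrow> act M x y 1 v \<in> U y"
  shows "submod r M U"
proof -
  interpret vector_space "scl M" by (rule mod_vector_space[OF M])
  have fin: "\<exists>B. finite B \<and> span B = U x" if x: "x \<in> Field r" for x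
  proof -
    obtain F where F: "finite F" "span F = obj M x" using mod_finite_span[OF M x] by blast
    obtain B where "finite B" "span B = U x"
      using finite_basis_of_subspace[OF subsp[OF x], of F] sub[OF x] F by metis
    then show ?thesis by blast
  qed
  have closed: "act M x y c v \<in> U y"
    if "x \<in> Field r" "y \<in> Field r" "c \<in> inc_hom r x y" "v \<in> U x" for x y c v
    using that(3)
  proof (cases rule: inc_hom_cases)
    case 1
    then have "act M x y c v = scl M c (act M x y 1 v)"
      using mod_act_coeff[OF M] sub that by blast
    then show ?thesis using act[OF 1 that(4)] subsp[OF that(2)] by (simp add: subspace_scale)
  next
    case 2
    then have "act M x y c v = 0" using mod_act_zero_coeff[OF M] sub that by blast
    then show ?thesis using subsp[OF that(2)] by (simp add: subspace_0)
  qed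
  have lin: "linear_between (scl M) (scl M) (U x) (U y) (act M x y c)"
    if h: "x \<in> Field r" "y \<in> Field r" "c \<in> inc_hom r x y" for x y c
  proof -
    have "linear_between (scl M) (scl M) (obj M x) (obj M y) (act M x y c)"
      using is_modD(3)[OF M] h by blast
    then show ?thesis
      using closed[OF h] sub[OF h(1)] unfolding linear_between_def by (simp add: Pi_iff subset_iff)
  qed
  have "is_mod r (M\<lparr>obj := U\<rparr>)"
    unfolding is_mod_def
    apply (intro conjI)
          apply (simp add: vector_space_axioms)
         apply (use fin subsp in simp)
        apply (use lin in simp)
       apply (use is_modD(4)[OF M] sub in \<open>simp add: subset_iff\<close>)
      apply (use is_modD(5)[OF M] sub in \<open>simp add: subset_iff\<close>)
     apply (use is_modD(6)[OF M] sub in \<open>simp add: subset_iff\<close>)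
    apply (use is_modD(7)[OF M] sub in \<open>simp add: subset_iff\<close>)
    done
  then show ?thesis using sub by (simp add: submod_def)
qed

lemma submod_is_mod: "submod r M U \<Longrightarrow> is_mod r (M\<lparr>obj := U\<rparr>)"
  by (simp add: submod_def)

lemma submod_subset: "submod r M U \<Longrightarrow> x \<in> Field r \<Longrightarrow> U x \<subseteq> obj M x"
  by (simp add: submod_def)

section \<open>Existence of indecomposable decompositions\<close>

text \<open>Subtracting two families with the same sum reduces uniqueness to families with sum 0.
  Restriction to \<open>{..<n}\<close> makes a family extensional, as the function space in
  \<open>indec_decomp\<close> requires.\<close>

lemma indec_decompI:
  assumes M: "is_mod r M"
    and D: "\<And>i. i < n \<Longrightarrow> submod r M (D i)"
    and ind: "\<And>i. i < n \<Longrightarrow> indecomposable r (M\<lparr>obj := D i\<rparr>)"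
    and ex: "\<And>x v. x \<in> Field r \<Longrightarrow> v \<in> obj M x \<Longrightarrow> \<exists>u. (\<forall>i<n. u i \<in> D i x) \<and> v = (\<Sum>i<n. u i)"
    and zero: "\<And>x u i. x \<in> Field r \<Longrightarrow> \<forall>i<n. u i \<in> D i x \<Longrightarrow> (\<Sum>i<n. u i) = 0 \<Longrightarrow> i < n \<Longrightarrow> u i = 0"
  shows "indec_decomp r M n D"
proof -
  have "\<exists>!u. u \<in> (\<Pi>\<^sub>E i\<in>{..<n}. D i x) \<and> v = (\<Sum>i<n. u i)"
    if x: "x \<in> Field r" and v: "v \<in> obj M x" for x v
  proof -
    obtain u where u: "\<forall>i<n. u i \<in> D i x" "v = (\<Sum>i<n. u i)" using ex[OF x v] by blast
    show ?thesis
    proof (rule ex1I[of _ "restrict u {..<n}"])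
      show "restrict u {..<n} \<in> (\<Pi>\<^sub>E i\<in>{..<n}. D i x) \<and> v = (\<Sum>i<n. restrict u {..<n} i)"
        using u by simp
    next
      fix w assume w: "w \<in> (\<Pi>\<^sub>E i\<in>{..<n}. D i x) \<and> v = (\<Sum>i<n. w i)"
      have "w i - u i = 0" if "i < n" for i
      proof (rule zero[OF x, of "\<lambda>i. w i - u i", OF _ _ that])
        show "\<forall>i<n. w i - u i \<in> D i x"
          using mod_diff_mem[OF submod_is_mod[OF D] x] w u(1) by (simp add: PiE_iff)
        show "(\<Sum>i<n. w i - u i) = 0" using w u(2) by (simp add: sum_subtractf)
      qed
      then show "w = restrict u {..<n}"
        using w by (intro PiE_ext[of w "{..<n}" "\<lambda>i. D i x"]) (use u in auto)
    qed
  qed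
  then show ?thesis using D ind by (simp add: indec_decomp_def)
qed

lemma indec_decomp_ex:
  assumes "indec_decomp r M n D" "x \<in> Field r" "v \<in> obj M x"
  shows "\<exists>u. (\<forall>i<n. u i \<in> D i x) \<and> v = (\<Sum>i<n. u i)"
proof -
  have "\<exists>u. u \<in> (\<Pi>\<^sub>E i\<in>{..<n}. D i x) \<and> v = (\<Sum>i<n. u i)"
    using assms unfolding indec_decomp_def by blast
  then show ?thesis by auto
qed

lemma indec_decomp_unique:
  assumes "indec_decomp r M n D" "x \<in> Field r" "(\<Sum>i<n. u i) \<in> obj M x"
    and "\<And>i. i < n \<Longrightarrow> u i \<in> D i x" "\<And>i. i < n \<Longrightarrow> w i \<in> D i x"
    and "(\<Sum>i<n. u i) = (\<Sum>i<n. w i)" and "j < n"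
  shows "u j = w j"
proof -
  have "\<exists>!f. f \<in> (\<Pi>\<^sub>E i\<in>{..<n}. D i x) \<and> (\<Sum>i<n. u i) = (\<Sum>i<n. f i)"
    using assms(1-3) unfolding indec_decomp_def by blast
  moreover have "restrict u {..<n} \<in> (\<Pi>\<^sub>E i\<in>{..<n}. D i x)"
    "restrict w {..<n} \<in> (\<Pi>\<^sub>E i\<in>{..<n}. D i x)"
    using assms(4,5) by auto
  moreover have "(\<Sum>i<n. u i) = (\<Sum>i<n. restrict u {..<n} i)"
    "(\<Sum>i<n. u i) = (\<Sum>i<n. restrict w {..<n} i)"
    using assms(6) by simp_all
  ultimately have "restrict u {..<n} = restrict w {..<n}" by blast
  then show ?thesis using assms(7) by (metis lessThan_iff restrict_apply')
qed

lemma sum_lessThan_add: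
  fixes f :: "nat \<Rightarrow> 'a::comm_monoid_add"
  shows "(\<Sum>i<m + n. f i) = (\<Sum>i<m. f i) + (\<Sum>i<n. f (m + i))"
  by (induction n) (simp_all add: add.assoc)

lemma indec_decomp_join:
  assumes M: "is_mod r M"
    and U: "submod r M U" and W: "submod r M W"
    and dir: "\<And>x. x \<in> Field r \<Longrightarrow> U x \<inter> W x = {0}"
    and sum: "\<And>x v. x \<in> Field r \<Longrightarrow> v \<in> obj M x \<Longrightarrow> \<exists>u\<in>U x. \<exists>w\<in>W x. v = u + w"
    and D: "indec_decomp r (M\<lparr>obj := U\<rparr>) m D" and E: "indec_decomp r (M\<lparr>obj := W\<rparr>) n E"
  shows "indec_decomp r M (m + n) (\<lambda>i. if i < m then D i else E (i - m))"
    (is "indec_decomp r M _ ?F")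
proof (rule indec_decompI[OF M])
  have DU: "submod r (M\<lparr>obj := U\<rparr>) (D i)" "indecomposable r (M\<lparr>obj := D i\<rparr>)" if "i < m" for i
    using D that by (auto simp: indec_decomp_def)
  have EW: "submod r (M\<lparr>obj := W\<rparr>) (E i)" "indecomposable r (M\<lparr>obj := E i\<rparr>)" if "i < n" for i
    using E that by (auto simp: indec_decomp_def)
  fix i assume i: "i < m + n"
  show "submod r M (?F i)"
    using DU(1)[of i] EW(1)[of "i - m"] U W i by (auto simp: submod_def subset_iff)
  show "indecomposable r (M\<lparr>obj := ?F i\<rparr>)"
    using DU(2)[of i] EW(2)[of "i - m"] i by auto
next
  fix x v assume x: "x \<in> Field r" and v: "v \<in> obj M x"
  obtain a b where ab: "a \<in> U x" "b \<in> W x" "v = a + b" using sum[OF x v] by blast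
  obtain u where u: "\<forall>i<m. u i \<in> D i x" "a = (\<Sum>i<m. u i)"
    using indec_decomp_ex[OF D x] ab by auto
  obtain w where w: "\<forall>i<n. w i \<in> E i x" "b = (\<Sum>i<n. w i)"
    using indec_decomp_ex[OF E x] ab by auto
  show "\<exists>u. (\<forall>i<m + n. u i \<in> ?F i x) \<and> v = (\<Sum>i<m + n. u i)"
    using u w ab(3)
    by (intro exI[of _ "\<lambda>i. if i < m then u i else w (i - m)"]) (auto simp: sum_lessThan_add)
next
  fix x u i
  assume x: "x \<in> Field r" and mem: "\<forall>i<m + n. u i \<in> ?F i x" and z: "(\<Sum>i<m + n. u i) = 0"
    and i: "i < m + n"
  have DU: "submod r (M\<lparr>obj := U\<rparr>) (D i)" if "i < m" for i
    using D that by (auto simp: indec_decomp_def)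
  have EW: "submod r (M\<lparr>obj := W\<rparr>) (E i)" if "i < n" for i
    using E that by (auto simp: indec_decomp_def)
  have uD: "u j \<in> D j x" if "j < m" for j using mem[rule_format, of j] that by simp
  have uE: "u (m + j) \<in> E j x" if "j < n" for j using mem[rule_format, of "m + j"] that by simp
  let ?a = "\<Sum>i<m. u i" and ?b = "\<Sum>i<n. u (m + i)"
  have "u j \<in> U x" if "j < m" for j using uD[OF that] submod_subset[OF DU[OF that] x] by auto
  then have a: "?a \<in> U x" using mod_sum_mem[OF submod_is_mod[OF U] x, of "{..<m}" u] by simp
  have "u (m + j) \<in> W x" if "j < n" for j using uE[OF that] submod_subset[OF EW[OF that] x] by auto
  then have b: "?b \<in> W x"
    using mod_sum_mem[OF submod_is_mod[OF W] x, of "{..<n}" "\<lambda>j. u (m + j)"] by simp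
  \<comment> \<open>The two halves of the relation are negatives of each other, hence lie in
    \<open>U x \<inter> W x\<close> and vanish separately. Then uniqueness applies in each
    piece.\<close>
  have ab: "?a + ?b = 0" using z by (simp add: sum_lessThan_add)
  have "0 - ?b \<in> W x"
    using mod_diff_mem[OF submod_is_mod[OF W] x, of 0 ?b] mod_zero_mem[OF submod_is_mod[OF W] x] b
    by simp
  moreover have "?a = 0 - ?b" using ab by (simp add: eq_neg_iff_add_eq_0)
  ultimately have "?a \<in> U x \<inter> W x" using a by simp
  then have a0: "?a = 0" using dir[OF x] by simp
  then have b0: "?b = 0" using ab by simp
  have z1: "\<And>j. j < m \<Longrightarrow> 0 \<in> D j x" using mod_zero_mem[OF submod_is_mod[OF DU] x] by simp
  have z2: "\<And>j. j < n \<Longrightarrow> 0 \<in> E j x" using mod_zero_mem[OF submod_is_mod[OF EW] x] by simp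
  show "u i = 0"
  proof (cases "i < m")
    case True
    show ?thesis
      by (rule indec_decomp_unique[OF D x, of u "\<lambda>_. 0", OF _ uD z1 _ True]) (use a a0 in auto)
  next
    case False
    have "u (m + (i - m)) = 0"
      by (rule indec_decomp_unique[OF E x, of "\<lambda>j. u (m + j)" "\<lambda>_. 0" "i - m", OF _ uE z2])
        (use b b0 i False in auto)
    then show ?thesis using False by simp
  qed
qed

text \<open>Induction on the total dimension: a nonzero module that is not indecomposable splits
  into two nonzero submodules, each of smaller total dimension.\<close>

lemma indec_decomp_exists:
  assumes "is_mod r M" "finite (Field r)"
  shows "\<exists>n D. indec_decomp r M n D"
  using assms(1)
proof (induction "\<Sum>x\<in>Field r. vector_space.dim (scl M) (obj M x)" arbitrary: M rule: less_induct)
  case (less M)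
  note M = less.prems
  interpret vector_space "scl M" by (rule mod_vector_space[OF M])
  consider "zero_fam r (obj M)" | "indecomposable r M" | "\<not> zero_fam r (obj M)" "\<not> indecomposable r M"
    by blast
  then show ?case
  proof cases
    case 1
    \<comment> \<open>The zero module is the sum of the empty family, whatever \<open>D\<close>
      is.\<close>
    then have "indec_decomp r M 0 D" for D
      by (auto simp: indec_decomp_def zero_fam_def)
    then show ?thesis by blast
  next
    case 2
    have "indec_decomp r M (Suc 0) (\<lambda>_. obj M)"
    proof (rule indec_decompI[OF M])
      show "\<exists>u. (\<forall>i<Suc 0. u i \<in> obj M x) \<and> v = (\<Sum>i<Suc 0. u i)" if "v \<in> obj M x" for x v
        by (rule exI[of _ "\<lambda>_. v"]) (use that in simp)
    qed (use M 2 in \<open>auto simp: submod_def\<close>)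
    then show ?thesis by blast
  next
    case 3
    then obtain U W where U: "submod r M U" and W: "submod r M W"
      and dir: "\<forall>x\<in>Field r. U x \<inter> W x = {0} \<and> (\<forall>v\<in>obj M x. \<exists>u\<in>U x. \<exists>w\<in>W x. v = u + w)"
      and nz: "\<not> zero_fam r U" "\<not> zero_fam r W"
      using M unfolding indecomposable_def by blast
    \<comment> \<open>At a point where \<open>T x\<close> is nonzero, \<open>S x\<close> is a proper
      subspace because it meets \<open>T x\<close> trivially; elsewhere its dimension cannot exceed
      that of \<open>obj M x\<close>.\<close>
    have smaller: "(\<Sum>x\<in>Field r. dim (S x)) < (\<Sum>x\<in>Field r. dim (obj M x))"
      if S: "submod r M S" and T: "submod r M T" "\<not> zero_fam r T"
        and ST: "\<forall>x\<in>Field r. S x \<inter> T x = {0}" for S T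
    proof (rule sum_strict_mono_ex1[OF assms(2)])
      have *: "subspace (S x)" "subspace (obj M x)" "S x \<subseteq> obj M x"
        "\<exists>F. finite F \<and> obj M x \<subseteq> span F" if "x \<in> Field r" for x
        using mod_subspace[OF submod_is_mod[OF S] that] mod_subspace[OF M that]
          submod_subset[OF S that] mod_finite_span[OF M that] by auto
      show "\<forall>x\<in>Field r. dim (S x) \<le> dim (obj M x)"
        using * dim_le_of_subset(1) by meson
      obtain x where x: "x \<in> Field r" "T x \<noteq> {0}" using T(2) by (auto simp: zero_fam_def)
      moreover have "0 \<in> T x" using mod_zero_mem[OF submod_is_mod[OF T(1)] x(1)] by simp
      ultimately have "S x \<noteq> obj M x"
        using ST submod_subset[OF T(1) x(1)] by blast
      then show "\<exists>x\<in>Field r. dim (S x) < dim (obj M x)"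
        using x *[OF x(1)] dim_le_of_subset(2) by meson
    qed
    have "\<exists>n D. indec_decomp r (M\<lparr>obj := U\<rparr>) n D"
      by (rule less.hyps) (use smaller[OF U W] dir nz U in \<open>auto simp: submod_def\<close>)
    moreover have "\<exists>n D. indec_decomp r (M\<lparr>obj := W\<rparr>) n D"
      by (rule less.hyps) (use smaller[OF W U] dir nz W in \<open>auto simp: submod_def Int_commute\<close>)
    ultimately show ?thesis using indec_decomp_join[OF M U W] dir by blast
  qed
qed

section \<open>Sections, cosections and the multiplicity of the constant module\<close>

lemma linear_between_add:
  "linear_between s t V W f \<Longrightarrow> u \<in> V \<Longrightarrow> v \<in> V \<Longrightarrow> f (u + v) = f u + f v"
  by (auto simp: linear_between_def)

lemma linear_between_scl:
  "linear_between s t V W f \<Longrightarrow> v \<in> V \<Longrightarrow> f (s a v) = t a (f v)"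
  by (auto simp: linear_between_def)

lemma linear_between_zero:
  assumes "linear_between s t V W f" "0 \<in> V"
  shows "f 0 = 0"
  using linear_between_add[OF assms(1,2,2)] by simp

lemma linear_between_diff:
  assumes "linear_between s t V W f" "u \<in> V" "v \<in> V" "u - v \<in> V"
  shows "f (u - v) = f u - f v"
  using linear_between_add[OF assms(1,4,3)] by simp

lemma linear_between_sum:
  assumes f: "linear_between s t V W f" and vs: "vector_space s" and V: "module.subspace s V"
    and u: "\<And>i. i \<in> A \<Longrightarrow> u i \<in> V"
  shows "f (sum u A) = (\<Sum>i\<in>A. f (u i))"
proof -
  interpret vector_space s by (rule vs)
  have "sum u A \<in> V \<and> f (sum u A) = (\<Sum>i\<in>A. f (u i))"
    using u
  proof (induction A rule: infinite_finite_induct)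
    case (insert i A)
    then have "u i \<in> V" "sum u A \<in> V" by simp_all
    then show ?case
      using insert V by (simp add: subspace_add linear_between_add[OF f])
  qed (use V subspace_0 linear_between_zero[OF f] in auto)
  then show ?thesis by simp
qed

definition is_section :: "'x rel \<Rightarrow> ('x, 'k::field, 'v::ab_group_add) rep \<Rightarrow> ('x \<Rightarrow> 'v) \<Rightarrow> bool" where
  "is_section r M s \<longleftrightarrow>
    (\<forall>x\<in>Field r. s x \<in> obj M x) \<and> (\<forall>x y. (x, y) \<in> r \<longrightarrow> act M x y 1 (s x) = s y)"

definition is_cosection ::
  "'x rel \<Rightarrow> ('x, 'k::field, 'v::ab_group_add) rep \<Rightarrow> ('x \<Rightarrow> 'v \<Rightarrow> 'k) \<Rightarrow> bool" where
  "is_cosection r M \<phi> \<longleftrightarrow>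
    (\<forall>x\<in>Field r. linear_between (scl M) (*) (obj M x) UNIV (\<phi> x)) \<and>
    (\<forall>x y v. (x, y) \<in> r \<and> v \<in> obj M x \<longrightarrow> \<phi> y (act M x y 1 v) = \<phi> x v)"

text \<open>Values away from \<open>Field r\<close> are left open, so that the pullback of an
  interval module to a poset mapping into the interval qualifies as it stands, without passing to an
  isomorphic copy.\<close>

definition constant_on :: "'x rel \<Rightarrow> ('x, 'k::field, 'k) rep \<Rightarrow> bool" where
  "constant_on r X \<longleftrightarrow>
    scl X = (*) \<and> (\<forall>x\<in>Field r. obj X x = UNIV) \<and>
    (\<forall>x\<in>Field r. \<forall>y\<in>Field r. \<forall>c v. act X x y c v = c * v)"

text \<open>Along \<open>a \<le> b\<close> the value at \<open>b\<close> is that of \<phi> on the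
  image of \<open>s a\<close>, which compatibility of \<phi> identifies with the value at
  \<open>a\<close>; connectedness carries this along paths. In other words, an endomorphism of the
  constant module is a scalar.\<close>

lemma pairing_constant:
  assumes conn: "conn_in r (Field r)" and s: "is_section r M s" and \<phi>: "is_cosection r M \<phi>"
    and x: "x \<in> Field r" and y: "y \<in> Field r"
  shows "\<phi> x (s x) = \<phi> y (s y)"
proof -
  have edge: "\<phi> a (s a) = \<phi> b (s b)" if "(a, b) \<in> r" for a b
  proof -
    have "a \<in> Field r" using that by (auto simp: Field_def)
    then have "s a \<in> obj M a" using s by (simp add: is_section_def)
    then have "\<phi> b (act M a b 1 (s a)) = \<phi> a (s a)"
      using \<phi> that unfolding is_cosection_def by blast
    then show ?thesis using s that by (simp add: is_section_def)
  qed
  have "(x, y) \<in> ((r \<union> r\<inverse>) \<inter> Field r \<times> Field r)\<^sup>*"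
    using conn x y by (simp add: conn_in_def)
  then show ?thesis
  proof (induction rule: rtrancl_induct)
    case (step a b)
    then have "(a, b) \<in> r \<or> (b, a) \<in> r" by blast
    then have "\<phi> a (s a) = \<phi> b (s b)" using edge[of a b] edge[of b a] by (elim disjE) simp_all
    then show ?case using step.IH by simp
  qed simp
qed

text \<open>Sections are the homomorphisms from the constant module \<open>X\<close> to \<open>N\<close>, cosections those from
  \<open>N\<close> to \<open>X\<close>. A nonzero composite \<open>X \<rightarrow> N \<rightarrow> X\<close> splits off a copy of \<open>X\<close>.\<close>

lemma indecomposable_iso_constant:
  fixes N :: "('x, 'k::field, 'v::ab_group_add) rep"
  assumes N: "indecomposable r N" and conn: "conn_in r (Field r)" and X: "constant_on r X"
    and t: "is_section r N t" and \<phi>: "is_cosection r N \<phi>"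
    and x0: "x0 \<in> Field r" "\<phi> x0 (t x0) \<noteq> 0"
  shows "mod_iso r N X"
proof -
  define c where "c = \<phi> x0 (t x0)"
  have M: "is_mod r N" using N by (simp add: indecomposable_def)
  interpret vector_space "scl N" by (rule mod_vector_space[OF M])
  have c: "\<phi> x (t x) = c" if "x \<in> Field r" for x
    using pairing_constant[OF conn t \<phi> that x0(1)] by (simp add: c_def)
  have c0: "c \<noteq> 0" using x0 by (simp add: c_def)
  have tm: "t x \<in> obj N x" if "x \<in> Field r" for x using t that by (simp add: is_section_def)
  have lin: "linear_between (scl N) (*) (obj N x) UNIV (\<phi> x)" if "x \<in> Field r" for x
    using \<phi> that by (simp add: is_cosection_def)
  note sclm = mod_scl_mem[OF M] and diffm = mod_diff_mem[OF M]
  \<comment> \<open>The image of \<open>t\<close> and the kernel of \<open>\<phi>\<close>. They are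
    complementary because \<open>\<phi>\<close> after \<open>t\<close> is multiplication by
    \<open>c\<close>, which is nonzero.\<close>
  define U where "U x = range (\<lambda>a. scl N a (t x))" for x
  define W where "W x = {v \<in> obj N x. \<phi> x v = 0}" for x
  have U: "submod r N U"
  proof (rule submodI[OF M])
    show "U x \<subseteq> obj N x" if "x \<in> Field r" for x
      using sclm tm that by (auto simp: U_def)
    show "subspace (U x)" for x
      unfolding U_def
    proof (rule subspaceI)
      show "0 \<in> range (\<lambda>a. scl N a (t x))" by (rule range_eqI[of _ _ 0]) simp
      show "u + v \<in> range (\<lambda>a. scl N a (t x))"
        if "u \<in> range (\<lambda>a. scl N a (t x))" "v \<in> range (\<lambda>a. scl N a (t x))" for u v
        using that by (auto simp: scale_left_distrib[symmetric])
      show "scl N b u \<in> range (\<lambda>a. scl N a (t x))"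
        if "u \<in> range (\<lambda>a. scl N a (t x))" for b u
        using that by auto
    qed
    show "act N x y 1 v \<in> U y" if xy: "(x, y) \<in> r" and v: "v \<in> U x" for x y v
    proof -
      obtain a where a: "v = scl N a (t x)" using v by (auto simp: U_def)
      have "x \<in> Field r" using xy by (auto simp: Field_def)
      then have "act N x y 1 v = scl N a (t y)"
        using mod_act_scl[OF M xy tm] t xy a by (simp add: is_section_def)
      then show ?thesis unfolding U_def by (rule range_eqI)
    qed
  qed
  have W: "submod r N W"
  proof (rule submodI[OF M])
    show "W x \<subseteq> obj N x" if "x \<in> Field r" for x by (auto simp: W_def)
    show "subspace (W x)" if x: "x \<in> Field r" for x
      unfolding W_def
      using mod_zero_mem[OF M x] mod_add_mem[OF M x] sclm[OF x] linear_between_zero[OF lin[OF x]]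
        linear_between_add[OF lin[OF x]] linear_between_scl[OF lin[OF x]]
      by (intro subspaceI) auto
    show "act N x y 1 v \<in> W y" if "(x, y) \<in> r" "v \<in> W x" for x y v
      using that mod_act_closed[OF M that(1)] \<phi> by (auto simp: W_def is_cosection_def)
  qed
  have "U x \<inter> W x = {0} \<and> (\<forall>v\<in>obj N x. \<exists>u\<in>U x. \<exists>w\<in>W x. v = u + w)" if x: "x \<in> Field r" for x
  proof (intro conjI ballI)
    have "0 \<in> U x" "0 \<in> W x"
      using mod_zero_mem[OF submod_is_mod[OF U] x] mod_zero_mem[OF submod_is_mod[OF W] x] by simp_all
    moreover have "scl N a (t x) = 0" if "scl N a (t x) \<in> W x" for a
      using that linear_between_scl[OF lin[OF x] tm[OF x]] c[OF x] c0 by (simp add: W_def)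
    ultimately show "U x \<inter> W x = {0}" by (auto simp: U_def)
  next
    fix v assume v: "v \<in> obj N x"
    \<comment> \<open>The projection of \<open>v\<close> to \<open>U x\<close> along the
      kernel.\<close>
    let ?u = "scl N (\<phi> x v / c) (t x)"
    have um: "?u \<in> obj N x" using sclm[OF x tm[OF x]] .
    have "\<phi> x (v - ?u) = 0"
      using linear_between_diff[OF lin[OF x] v um diffm[OF x v um]]
        linear_between_scl[OF lin[OF x] tm[OF x]] c[OF x] c0 by simp
    then have "v - ?u \<in> W x" using diffm[OF x v um] by (simp add: W_def)
    moreover have "?u \<in> U x" unfolding U_def by (rule rangeI)
    ultimately show "\<exists>u\<in>U x. \<exists>w\<in>W x. v = u + w"
      by (intro bexI[of _ ?u] bexI[of _ "v - ?u"]) simp_all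
  qed
  then have "zero_fam r U \<or> zero_fam r W"
    using N U W unfolding indecomposable_def by blast
  moreover have "\<not> zero_fam r U"
  proof
    assume "zero_fam r U"
    moreover have "t x0 \<in> U x0" unfolding U_def by (rule range_eqI[of _ _ 1]) simp
    ultimately have "t x0 = 0" using x0 by (auto simp: zero_fam_def)
    then show False
      using x0 linear_between_zero[OF lin[OF x0(1)] mod_zero_mem[OF M x0(1)]] by simp
  qed
  ultimately have "zero_fam r W" by blast
  then have W0: "W x = {0}" if "x \<in> Field r" for x using that by (simp add: zero_fam_def)
  \<comment> \<open>The vanishing kernel makes \<open>\<phi>\<close> injective and
    \<open>\<phi> x (t x) = c \<noteq> 0\<close> makes it surjective, so \<open>\<phi>\<close>
    itself is the isomorphism.\<close>
  show ?thesis
    unfolding mod_iso_def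
  proof (intro exI[of _ \<phi>] conjI ballI)
    fix x assume x: "x \<in> Field r"
    have oX: "obj X x = UNIV" and sX: "scl X = (*)" using X x by (simp_all add: constant_on_def)
    show "linear_between (scl N) (scl X) (obj N x) (obj X x) (\<phi> x)"
      using lin[OF x] by (simp add: oX sX)
    show "bij_betw (\<phi> x) (obj N x) (obj X x)"
      unfolding bij_betw_def oX
    proof
      show "inj_on (\<phi> x) (obj N x)"
      proof (rule inj_onI)
        fix u v assume uv: "u \<in> obj N x" "v \<in> obj N x" "\<phi> x u = \<phi> x v"
        then have "u - v \<in> W x"
          using diffm[OF x] linear_between_diff[OF lin[OF x]] by (simp add: W_def)
        then show "u = v" using W0[OF x] by simp
      qed
      have "a \<in> \<phi> x ` obj N x" for a
      proof (rule image_eqI)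
        show "a = \<phi> x (scl N (a / c) (t x))"
          using linear_between_scl[OF lin[OF x] tm[OF x]] c[OF x] c0 by simp
        show "scl N (a / c) (t x) \<in> obj N x" using sclm[OF x tm[OF x]] .
      qed
      then show "\<phi> x ` obj N x = UNIV" by (rule UNIV_eq_I[symmetric])
    qed
  next
    fix x y and a :: 'k and v
    assume xy: "x \<in> Field r" "y \<in> Field r" and a: "a \<in> inc_hom r x y" and v: "v \<in> obj N x"
    have "\<phi> y (act N x y a v) = a * \<phi> x v"
      using a
    proof (cases rule: inc_hom_cases)
      case 1
      have "\<phi> y (act N x y a v) = \<phi> y (scl N a (act N x y 1 v))"
        by (rule arg_cong[OF mod_act_coeff[OF M 1 v]])
      also have "\<dots> = a * \<phi> y (act N x y 1 v)"
        by (rule linear_between_scl[OF lin[OF xy(2)] mod_act_closed[OF M 1 v]])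
      finally show ?thesis using \<phi> 1 v unfolding is_cosection_def by metis
    next
      case 2
      then show ?thesis
        using mod_act_zero_coeff[OF M xy v]
          linear_between_zero[OF lin[OF xy(2)] mod_zero_mem[OF M xy(2)]] by simp
    qed
    then show "\<phi> y (act N x y a v) = act X x y a (\<phi> x v)"
      using X xy by (simp add: constant_on_def)
  qed
qed

text \<open>A dual system identifies the pairing of cosections with sections with the standard pairing of
  \<open>k\<^sup>B\<close> with itself, up to the radicals. Its size is the rank of this pairing.\<close>

definition dual_system ::
  "'x rel \<Rightarrow> ('x, 'k::field, 'v::ab_group_add) rep \<Rightarrow> 'i set \<Rightarrow> ('i \<Rightarrow> 'x \<Rightarrow> 'v) \<Rightarrow>
    ('i \<Rightarrow> 'x \<Rightarrow> 'v \<Rightarrow> 'k) \<Rightarrow> bool" where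
  "dual_system r M B \<sigma> \<theta> \<longleftrightarrow>
    finite B \<and> (\<forall>l\<in>B. is_section r M (\<sigma> l) \<and> is_cosection r M (\<theta> l)) \<and>
    (\<exists>q\<in>Field r.
      (\<forall>i\<in>B. \<forall>j\<in>B. \<theta> i q (\<sigma> j q) = (if i = j then 1 else 0)) \<and>
      (\<forall>s \<phi>. is_section r M s \<and> is_cosection r M \<phi> \<longrightarrow>
        \<phi> q (s q) = (\<Sum>l\<in>B. \<phi> q (\<sigma> l q) * \<theta> l q (s q))))"

section \<open>Invariance of the size of a dual system\<close>

lemma sum_fun_apply: "(\<Sum>i\<in>A. f i) x = (\<Sum>i\<in>A. f i x)"
  by (induction A rule: infinite_finite_induct) auto

text \<open>The identity matrix on \<open>B\<close> factors through a space of dimension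
  \<open>card C\<close>. A linear relation among the rows of \<open>a\<close>, multiplied by column
  \<open>j\<close> of \<open>b\<close>, leaves only its coefficient at \<open>j\<close>, so the rows
  are independent.\<close>

lemma card_le_of_identity_factorization:
  fixes a :: "'i \<Rightarrow> 'j \<Rightarrow> 'k::field"
  assumes fB: "finite B" and fC: "finite C"
    and ab: "\<And>i j. i \<in> B \<Longrightarrow> j \<in> B \<Longrightarrow> (\<Sum>l\<in>C. a i l * b l j) = (if i = j then 1 else 0)"
  shows "card B \<le> card C"
proof -
  interpret V: vector_space "\<lambda>(c::'k) (f::'j \<Rightarrow> 'k) x. c * f x"
    by unfold_locales (auto simp: algebra_simps)
  define e where "e l = (\<lambda>x. if x = l then 1 else (0::'k))" for l :: 'j
  \<comment> \<open>Row \<open>i\<close> of \<open>a\<close>, cut off outside \<open>C\<close> so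
    that it lies in the span of the finitely many \<open>e l\<close> with
    \<open>l \<in> C\<close>.\<close>
  define \<rho> where "\<rho> i = (\<Sum>l\<in>C. (\<lambda>x. a i l * e l x))" for i
  have \<rho>: "\<rho> i l = a i l" if "l \<in> C" for i l
    using that fC by (simp add: \<rho>_def sum_fun_apply e_def if_distrib[of "\<lambda>x. _ * x"] cong: if_cong)
  \<comment> \<open>Independence concerns sets of vectors, so the rows have to be distinct for their
    number to be \<open>card B\<close>.\<close>
  have inj: "inj_on \<rho> B"
  proof (rule inj_onI)
    fix i j assume ij: "i \<in> B" "j \<in> B" "\<rho> i = \<rho> j"
    then have "(\<Sum>l\<in>C. a i l * b l j) = (\<Sum>l\<in>C. a j l * b l j)"
      by (intro sum.cong) (simp_all add: \<rho>[symmetric])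
    then show "i = j" using ab[OF ij(1,2)] ab[OF ij(2,2)] by (simp split: if_splits)
  qed
  have "V.independent (\<rho> ` B)"
  proof (rule V.independent_if_scalars_zero)
    fix f x assume z: "(\<Sum>x\<in>\<rho> ` B. (\<lambda>l. f x * x l)) = 0" and "x \<in> \<rho> ` B"
    then obtain j where j: "j \<in> B" "x = \<rho> j" by blast
    have z': "(\<Sum>i\<in>B. f (\<rho> i) * \<rho> i l) = 0" for l
      using fun_cong[OF z, of l] by (simp add: sum_fun_apply sum.reindex[OF inj])
    have "0 = (\<Sum>l\<in>C. (\<Sum>i\<in>B. f (\<rho> i) * \<rho> i l) * b l j)" by (simp add: z')
    also have "\<dots> = (\<Sum>i\<in>B. f (\<rho> i) * (\<Sum>l\<in>C. a i l * b l j))"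
      by (subst sum_distrib_left, subst sum_distrib_right, subst sum.swap)
        (simp add: \<rho> mult.assoc)
    also have "\<dots> = (\<Sum>i\<in>B. if i = j then f (\<rho> i) else 0)"
      using ab j(1) by (intro sum.cong) simp_all
    also have "\<dots> = f x" using fB j by simp
    finally show "f x = 0" by simp
  qed (use fB in simp)
  moreover have "\<rho> ` B \<subseteq> V.span (e ` C)"
  proof (rule image_subsetI)
    fix i
    have "(\<lambda>x. a i l * e l x) \<in> V.span (e ` C)" if "l \<in> C" for l
      by (rule V.span_scale) (rule V.span_base[OF imageI[OF that]])
    then show "\<rho> i \<in> V.span (e ` C)"
      unfolding \<rho>_def by (rule V.span_sum)
  qed
  ultimately have "card (\<rho> ` B) \<le> card (e ` C)"
    using V.independent_span_bound fC by blast
  also have "\<dots> \<le> card C" using fC by (rule card_image_le)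
  finally show ?thesis using card_image[OF inj] by simp
qed

text \<open>Expanding the pairings of the first system in the second factors the identity matrix on
  \<open>B\<close> through \<open>C\<close>. The base points \<open>q\<close> and \<open>p\<close>
  of the two systems may differ; constancy of the pairing moves from one to the other.\<close>

lemma dual_system_card_le:
  assumes conn: "conn_in r (Field r)"
    and B: "dual_system r M B \<sigma> \<theta>" and C: "dual_system r M C \<sigma>' \<theta>'"
  shows "card B \<le> card C"
proof -
  obtain q where q: "q \<in> Field r"
    "\<forall>i\<in>B. \<forall>j\<in>B. \<theta> i q (\<sigma> j q) = (if i = j then 1 else 0)"
    using B unfolding dual_system_def by blast
  obtain p where p: "p \<in> Field r"
    "\<forall>s \<phi>. is_section r M s \<and> is_cosection r M \<phi> \<longrightarrow>
      \<phi> p (s p) = (\<Sum>l\<in>C. \<phi> p (\<sigma>' l p) * \<theta>' l p (s p))"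
    using C unfolding dual_system_def by blast
  have fin: "finite B" "finite C" using B C by (simp_all add: dual_system_def)
  have sec: "is_section r M (\<sigma> i)" "is_cosection r M (\<theta> i)" if "i \<in> B" for i
    using B that by (simp_all add: dual_system_def)
  show ?thesis
  proof (rule card_le_of_identity_factorization[OF fin])
    fix i j assume ij: "i \<in> B" "j \<in> B"
    have "(\<Sum>l\<in>C. \<theta> i p (\<sigma>' l p) * \<theta>' l p (\<sigma> j p)) = \<theta> i p (\<sigma> j p)"
      using p(2) sec ij by simp
    also have "\<dots> = \<theta> i q (\<sigma> j q)"
      using pairing_constant[OF conn] sec ij p(1) q(1) by blast
    finally show "(\<Sum>l\<in>C. \<theta> i p (\<sigma>' l p) * \<theta>' l p (\<sigma> j p)) = (if i = j then 1 else 0)"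
      using q(2) ij by simp
  qed
qed

text \<open>The components of \<open>v\<close> in the summands. Values at indices from
  \<open>n\<close> on are arbitrary, which is why the family is chosen and not described as
  unique.\<close>

definition part ::
  "('x, 'k::field, 'v::ab_group_add) rep \<Rightarrow> nat \<Rightarrow> (nat \<Rightarrow> 'x \<Rightarrow> 'v set) \<Rightarrow> 'x \<Rightarrow> 'v \<Rightarrow> nat \<Rightarrow> 'v" where
  "part M n D x v = (SOME u. (\<forall>i<n. u i \<in> D i x) \<and> v = (\<Sum>i<n. u i))"

section \<open>Projections onto the summands of a decomposition\<close>

context
  fixes r :: "'x rel" and M :: "('x, 'k::field, 'v::ab_group_add) rep"
    and n :: nat and D :: "nat \<Rightarrow> 'x \<Rightarrow> 'v set"
  assumes M: "is_mod r M" and D: "indec_decomp r M n D"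
begin

lemma decomp_submod: "i < n \<Longrightarrow> submod r M (D i)"
  using D by (simp add: indec_decomp_def)

lemma decomp_obj: "i < n \<Longrightarrow> x \<in> Field r \<Longrightarrow> v \<in> D i x \<Longrightarrow> v \<in> obj M x"
  using submod_subset[OF decomp_submod] by blast

lemma
  assumes "x \<in> Field r" "v \<in> obj M x"
  shows part_mem: "i < n \<Longrightarrow> part M n D x v i \<in> D i x"
    and part_sum: "v = (\<Sum>i<n. part M n D x v i)"
proof -
  have "(\<forall>i<n. part M n D x v i \<in> D i x) \<and> v = (\<Sum>i<n. part M n D x v i)"
    unfolding part_def by (rule someI_ex[OF indec_decomp_ex[OF D assms]])
  then show "i < n \<Longrightarrow> part M n D x v i \<in> D i x" "v = (\<Sum>i<n. part M n D x v i)" by blast+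
qed

text \<open>Reduces additivity, homogeneity and naturality of the projections to exhibiting a family
  with the right sum.\<close>

lemma part_eqI:
  assumes x: "x \<in> Field r" and u: "\<And>i. i < n \<Longrightarrow> u i \<in> D i x" and v: "v = (\<Sum>i<n. u i)" and i: "i < n"
  shows "part M n D x v i = u i"
proof -
  have vm: "v \<in> obj M x"
    unfolding v by (rule mod_sum_mem[OF M x]) (use decomp_obj[OF _ x] u in simp)
  have eq: "(\<Sum>i<n. part M n D x v i) = (\<Sum>i<n. u i)"
    using part_sum[OF x vm] v by simp
  show ?thesis
    by (rule indec_decomp_unique[OF D x _ part_mem[OF x vm] u eq i])
      (use part_sum[OF x vm] vm in auto)
qed

lemma part_add:
  assumes x: "x \<in> Field r" and uv: "u \<in> obj M x" "v \<in> obj M x" and i: "i < n"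
  shows "part M n D x (u + v) i = part M n D x u i + part M n D x v i"
proof (rule part_eqI[OF x _ _ i])
  show "part M n D x u i + part M n D x v i \<in> D i x" if "i < n" for i
    using mod_add_mem[OF submod_is_mod[OF decomp_submod[OF that]] x] part_mem[OF x] uv that by simp
  show "u + v = (\<Sum>i<n. part M n D x u i + part M n D x v i)"
    using part_sum[OF x] uv by (simp add: sum.distrib)
qed

lemma part_scl:
  assumes x: "x \<in> Field r" and v: "v \<in> obj M x" and i: "i < n"
  shows "part M n D x (scl M a v) i = scl M a (part M n D x v i)"
proof (rule part_eqI[OF x _ _ i])
  interpret vector_space "scl M" by (rule mod_vector_space[OF M])
  show "scl M a (part M n D x v i) \<in> D i x" if "i < n" for i
    using mod_scl_mem[OF submod_is_mod[OF decomp_submod[OF that]] x] part_mem[OF x] v that by simp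
  show "scl M a v = (\<Sum>i<n. scl M a (part M n D x v i))"
    using part_sum[OF x v] by (simp add: scale_sum_right[symmetric])
qed

lemma part_act:
  assumes xy: "(x, y) \<in> r" and v: "v \<in> obj M x" and i: "i < n"
  shows "part M n D y (act M x y 1 v) i = act M x y 1 (part M n D x v i)"
proof (rule part_eqI[OF _ _ _ i])
  have x: "x \<in> Field r" using xy by (auto simp: Field_def)
  show "y \<in> Field r" using xy by (auto simp: Field_def)
  show "act M x y 1 (part M n D x v i) \<in> D i y" if "i < n" for i
    using mod_act_closed[OF submod_is_mod[OF decomp_submod[OF that]] xy] part_mem[OF x v] that by simp
  have "act M x y 1 (\<Sum>i<n. part M n D x v i) = (\<Sum>i<n. act M x y 1 (part M n D x v i))"
    by (rule linear_between_sum[OF mod_act_linear[OF M xy] mod_vector_space[OF M] mod_subspace[OF M x]])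
      (use decomp_obj[OF _ x] part_mem[OF x v] in simp)
  then show "act M x y 1 v = (\<Sum>i<n. act M x y 1 (part M n D x v i))"
    using part_sum[OF x v] by simp
qed

text \<open>A summand isomorphic to \<open>X\<close> gives a section by inclusion and a cosection by
  projection. Any other summand contributes nothing to a pairing, since a nonzero contribution would
  make it isomorphic to \<open>X\<close>.\<close>

lemma indec_decomp_dual_system:
  fixes X :: "('x, 'k, 'k) rep"
  assumes conn: "conn_in r (Field r)" and ne: "Field r \<noteq> {}" and X: "constant_on r X"
  shows "\<exists>\<sigma> \<theta>. dual_system r M {i. i < n \<and> mod_iso r (M\<lparr>obj := D i\<rparr>) X} \<sigma> \<theta>"
proof -
  interpret vector_space "scl M" by (rule mod_vector_space[OF M])
  define B where "B = {i. i < n \<and> mod_iso r (M\<lparr>obj := D i\<rparr>) X}"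
  have "\<forall>i\<in>B. \<exists>f. (\<forall>x\<in>Field r. linear_between (scl M) (*) (D i x) UNIV (f x) \<and>
      bij_betw (f x) (D i x) UNIV) \<and>
      (\<forall>x y v. (x, y) \<in> r \<longrightarrow> v \<in> D i x \<longrightarrow> f y (act M x y 1 v) = f x v)"
  proof
    fix i assume "i \<in> B"
    then obtain f where f:
      "\<forall>x\<in>Field r. linear_between (scl M) (scl X) (D i x) (obj X x) (f x) \<and>
        bij_betw (f x) (D i x) (obj X x)"
      "\<forall>x\<in>Field r. \<forall>y\<in>Field r. \<forall>c\<in>inc_hom r x y. \<forall>v\<in>D i x.
        f y (act M x y c v) = act X x y c (f x v)"
      by (auto simp: B_def mod_iso_def)
    show "\<exists>f. (\<forall>x\<in>Field r. linear_between (scl M) (*) (D i x) UNIV (f x) \<and>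
      bij_betw (f x) (D i x) UNIV) \<and>
      (\<forall>x y v. (x, y) \<in> r \<longrightarrow> v \<in> D i x \<longrightarrow> f y (act M x y 1 v) = f x v)"
    proof (intro exI[of _ f] conjI allI impI)
      show "\<forall>x\<in>Field r. linear_between (scl M) (*) (D i x) UNIV (f x) \<and>
        bij_betw (f x) (D i x) UNIV"
        using f(1) X by (simp add: constant_on_def)
      fix x y v assume xy: "(x, y) \<in> r" and v: "v \<in> D i x"
      have xF: "x \<in> Field r" and yF: "y \<in> Field r" using xy by (auto simp: Field_def)
      then have "f y (act M x y 1 v) = act X x y 1 (f x v)"
        using f(2) inc_hom_le[OF xy, of 1] v by blast
      then show "f y (act M x y 1 v) = f x v"
        using X xF yF by (simp add: constant_on_def)
    qed
  qed
  then obtain f where f: "\<forall>i\<in>B. (\<forall>x\<in>Field r. linear_between (scl M) (*) (D i x) UNIV (f i x) \<and>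
      bij_betw (f i x) (D i x) UNIV) \<and>
      (\<forall>x y v. (x, y) \<in> r \<longrightarrow> v \<in> D i x \<longrightarrow> f i y (act M x y 1 v) = f i x v)"
    by (rule bchoice[THEN exE])
  have flin: "linear_between (scl M) (*) (D i x) UNIV (f i x)" if "i \<in> B" "x \<in> Field r" for i x
    using f that by blast
  have fbij: "bij_betw (f i x) (D i x) UNIV" if "i \<in> B" "x \<in> Field r" for i x
    using f that by blast
  have f_act: "f i y (act M x y 1 v) = f i x v" if "i \<in> B" "(x, y) \<in> r" "v \<in> D i x" for i x y v
    using f that by blast
  have finj: "u = v" if "i \<in> B" "x \<in> Field r" "u \<in> D i x" "v \<in> D i x" "f i x u = f i x v" for i x u v
    using fbij[OF that(1,2)] that(3-5) by (auto simp: bij_betw_def dest: inj_onD)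
  have Bn: "i < n" if "i \<in> B" for i using that by (simp add: B_def)
  \<comment> \<open>The element of the summand that corresponds to 1 in \<open>X\<close>;
    \<open>inv_into\<close> is a genuine inverse here, \<open>f i x\<close> being bijective onto the
    field.\<close>
  define \<sigma> where "\<sigma> i x = inv_into (D i x) (f i x) 1" for i x
  define \<theta> where "\<theta> i x v = f i x (part M n D x v i)" for i x v
  have \<sigma>m: "\<sigma> i x \<in> D i x" and f\<sigma>: "f i x (\<sigma> i x) = 1" if "i \<in> B" "x \<in> Field r" for i x
    using fbij[OF that] by (auto simp: \<sigma>_def bij_betw_def inv_into_into f_inv_into_f)
  have sec: "is_section r M (\<sigma> i)" if i: "i \<in> B" for i
    unfolding is_section_def
  proof (intro conjI ballI allI impI)
    show "\<sigma> i x \<in> obj M x" if "x \<in> Field r" for x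
      using \<sigma>m[OF i that] decomp_obj[OF Bn[OF i] that] by blast
    fix x y assume xy: "(x, y) \<in> r"
    have x: "x \<in> Field r" and y: "y \<in> Field r" using xy by (auto simp: Field_def)
    have "act M x y 1 (\<sigma> i x) \<in> D i y"
      using mod_act_closed[OF submod_is_mod[OF decomp_submod[OF Bn[OF i]]] xy] \<sigma>m[OF i x] by simp
    then show "act M x y 1 (\<sigma> i x) = \<sigma> i y"
      by (rule finj[OF i y _ \<sigma>m[OF i y]]) (simp add: f_act[OF i xy \<sigma>m[OF i x]] f\<sigma>[OF i x] f\<sigma>[OF i y])
  qed
  have cosec: "is_cosection r M (\<theta> i)" if i: "i \<in> B" for i
    unfolding is_cosection_def
  proof (intro conjI ballI allI impI)
    fix x assume x: "x \<in> Field r"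
    show "linear_between (scl M) (*) (obj M x) UNIV (\<theta> i x)"
      unfolding linear_between_def \<theta>_def
      by (simp add: part_add[OF x _ _ Bn[OF i]] part_scl[OF x _ Bn[OF i]] part_mem[OF x _ Bn[OF i]]
          linear_between_add[OF flin[OF i x]] linear_between_scl[OF flin[OF i x]])
  next
    fix x y v assume xy: "(x, y) \<in> r \<and> v \<in> obj M x"
    then have "x \<in> Field r" by (auto simp: Field_def)
    then show "\<theta> i y (act M x y 1 v) = \<theta> i x v"
      using xy by (simp add: \<theta>_def part_act[OF _ _ Bn[OF i]] f_act[OF i] part_mem Bn[OF i])
  qed
  obtain q where q: "q \<in> Field r" using ne by blast
  have zD: "0 \<in> D i q" if "i < n" for i
    using mod_zero_mem[OF submod_is_mod[OF decomp_submod[OF that]] q] by simp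
  have biorth: "\<theta> i q (\<sigma> j q) = (if i = j then 1 else 0)" if ij: "i \<in> B" "j \<in> B" for i j
  proof -
    have "part M n D q (\<sigma> j q) i = (if i = j then \<sigma> j q else 0)"
      by (rule part_eqI[OF q, of "\<lambda>i. if i = j then \<sigma> j q else 0"])
        (use zD \<sigma>m[OF ij(2) q] Bn[OF ij(1)] Bn[OF ij(2)] in auto)
    then show ?thesis
      using f\<sigma>[OF ij(1) q] linear_between_zero[OF flin[OF ij(1) q] zD[OF Bn[OF ij(1)]]]
      by (cases "i = j") (simp_all add: \<theta>_def)
  qed
  have expand: "\<phi> q (s q) = (\<Sum>l\<in>B. \<phi> q (\<sigma> l q) * \<theta> l q (s q))"
    if s: "is_section r M s" and \<phi>: "is_cosection r M \<phi>" for s \<phi>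
  proof -
    have sm: "s x \<in> obj M x" if "x \<in> Field r" for x using s that by (simp add: is_section_def)
    have lin: "linear_between (scl M) (*) (obj M x) UNIV (\<phi> x)" if "x \<in> Field r" for x
      using \<phi> that by (simp add: is_cosection_def)
    define t where "t i x = part M n D x (s x) i" for i x
    have tm: "t i x \<in> D i x" if "i < n" "x \<in> Field r" for i x
      unfolding t_def by (rule part_mem[OF that(2) sm[OF that(2)] that(1)])
    have "\<phi> q (s q) = \<phi> q (\<Sum>i<n. t i q)"
      using part_sum[OF q sm[OF q]] by (simp add: t_def)
    also have "\<dots> = (\<Sum>i<n. \<phi> q (t i q))"
      by (rule linear_between_sum[OF lin[OF q] mod_vector_space[OF M] mod_subspace[OF M q]])
        (use decomp_obj[OF _ q] tm q in simp)
    also have "\<dots> = (\<Sum>i\<in>B. \<phi> q (t i q))"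
    proof (rule sum.mono_neutral_right)
      show "B \<subseteq> {..<n}" using Bn by auto
      \<comment> \<open>With a nonzero term, the component \<open>t i\<close> of \<open>s\<close>
        and the restriction of \<open>\<phi>\<close> would pair to a nonzero scalar on the
        indecomposable summand \<open>D i\<close>, which forces \<open>i \<in> B\<close>.\<close>
      show "\<forall>i\<in>{..<n} - B. \<phi> q (t i q) = 0"
      proof (rule ballI, rule ccontr)
        fix i assume i: "i \<in> {..<n} - B" and nz: "\<phi> q (t i q) \<noteq> 0"
        have "is_section r (M\<lparr>obj := D i\<rparr>) (t i)"
          unfolding is_section_def
        proof (intro conjI ballI allI impI)
          fix x y assume xy: "(x, y) \<in> r"
          then have "x \<in> Field r" by (auto simp: Field_def)
          then show "act (M\<lparr>obj := D i\<rparr>) x y 1 (t i x) = t i y"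
            using part_act[OF xy sm, of i] i s xy by (simp add: t_def is_section_def)
        qed (use tm i in simp)
        moreover have "is_cosection r (M\<lparr>obj := D i\<rparr>) \<phi>"
          unfolding is_cosection_def
        proof (intro conjI ballI allI impI)
          fix x assume x: "x \<in> Field r"
          have "D i x \<subseteq> obj M x" using decomp_obj[of i] x i by auto
          then show "linear_between (scl (M\<lparr>obj := D i\<rparr>)) (*) (obj (M\<lparr>obj := D i\<rparr>) x) UNIV (\<phi> x)"
            using lin[OF x] unfolding linear_between_def by (simp add: subset_iff)
        next
          fix x y v assume xy: "(x, y) \<in> r \<and> v \<in> obj (M\<lparr>obj := D i\<rparr>) x"
          then have "x \<in> Field r" by (auto simp: Field_def)
          then have "v \<in> obj M x" using decomp_obj[of i x v] xy i by simp
          then show "\<phi> y (act (M\<lparr>obj := D i\<rparr>) x y 1 v) = \<phi> x v"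
            using \<phi> xy by (simp add: is_cosection_def)
        qed
        moreover have "indecomposable r (M\<lparr>obj := D i\<rparr>)"
          using D i by (simp add: indec_decomp_def)
        ultimately have "mod_iso r (M\<lparr>obj := D i\<rparr>) X"
          using indecomposable_iso_constant[OF _ conn X, of _ "t i" \<phi> q] q nz by blast
        then show False using i by (simp add: B_def)
      qed
    qed simp
    also have "\<dots> = (\<Sum>i\<in>B. \<phi> q (\<sigma> i q) * \<theta> i q (s q))"
    proof (rule sum.cong[OF refl])
      fix i assume i: "i \<in> B"
      \<comment> \<open>\<open>D i q\<close> is the line spanned by \<open>\<sigma> i q\<close>, and
        \<open>f i q\<close> is the coordinate on it.\<close>
      have "scl M (f i q (t i q)) (\<sigma> i q) \<in> D i q"
        using mod_scl_mem[OF submod_is_mod[OF decomp_submod[OF Bn[OF i]]] q] \<sigma>m[OF i q] by simp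
      then have "t i q = scl M (f i q (t i q)) (\<sigma> i q)"
        by (rule finj[OF i q tm[OF Bn[OF i] q]])
          (simp add: linear_between_scl[OF flin[OF i q] \<sigma>m[OF i q]] f\<sigma>[OF i q])
      then have "\<phi> q (t i q) = \<phi> q (scl M (f i q (t i q)) (\<sigma> i q))" by (rule arg_cong)
      also have "\<dots> = f i q (t i q) * \<phi> q (\<sigma> i q)"
        by (rule linear_between_scl[OF lin[OF q] decomp_obj[OF Bn[OF i] q \<sigma>m[OF i q]]])
      finally show "\<phi> q (t i q) = \<phi> q (\<sigma> i q) * \<theta> i q (s q)"
        by (simp add: \<theta>_def t_def)
    qed
    finally show ?thesis .
  qed
  have "finite B" by (simp add: B_def)
  then have "dual_system r M B \<sigma> \<theta>"
    unfolding dual_system_def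
  proof (intro conjI ballI bexI[of _ q] allI impI)
    show "\<phi> q (s q) = (\<Sum>l\<in>B. \<phi> q (\<sigma> l q) * \<theta> l q (s q))"
      if "is_section r M s \<and> is_cosection r M \<phi>" for s \<phi>
      using that by (elim conjE) (rule expand)
  qed (use sec cosec biorth q in simp_all)
  then show ?thesis unfolding B_def by (intro exI)
qed

end

text \<open>Every decomposition yields a dual system indexed by its copies of \<open>X\<close>, and
  two dual systems bound each other's size. As decompositions exist, \<open>card B\<close> is the
  one number that \<open>THE\<close> can denote.\<close>

lemma multiplicity_constant_eq_card:
  fixes X :: "('x, 'k::field, 'k) rep" and M :: "('x, 'k, 'v::ab_group_add) rep"
  assumes M: "is_mod r M" and fin: "finite (Field r)"
    and conn: "conn_in r (Field r)" and X: "constant_on r X" and B: "dual_system r M B \<sigma> \<theta>"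
  shows "multiplicity r X M = card B"
proof -
  have ne: "Field r \<noteq> {}" using B unfolding dual_system_def by blast
  have eq: "card {i. i < n \<and> mod_iso r (M\<lparr>obj := D i\<rparr>) X} = card B" if D: "indec_decomp r M n D" for n D
  proof -
    obtain \<sigma>' \<theta>' where "dual_system r M {i. i < n \<and> mod_iso r (M\<lparr>obj := D i\<rparr>) X} \<sigma>' \<theta>'"
      using indec_decomp_dual_system[OF M D conn ne X] by blast
    then show ?thesis
      by (intro le_antisym dual_system_card_le[OF conn _ B] dual_system_card_le[OF conn B])
  qed
  obtain n D where D: "indec_decomp r M n D" using indec_decomp_exists[OF M fin] by blast
  show ?thesis
    unfolding multiplicity_def
  proof (rule the_equality)
    show "\<exists>n D. indec_decomp r M n D \<and> card B = card {i. i < n \<and> mod_iso r (M\<lparr>obj := D i\<rparr>) X}"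
      using D eq[OF D] by (intro exI[of _ n] exI[of _ D]) simp
  next
    fix m
    assume "\<exists>n D. indec_decomp r M n D \<and> m = card {i. i < n \<and> mod_iso r (M\<lparr>obj := D i\<rparr>) X}"
    then show "m = card B" using eq by (elim exE conjE) simp
  qed
qed

section \<open>Intervals of a finite poset\<close>

context
  fixes P :: "'p rel"
  assumes P: "finite_poset P"
begin

lemma poset_refl: "x \<in> Field P \<Longrightarrow> (x, x) \<in> P"
  using P by (auto simp: finite_poset_def partial_order_on_def preorder_on_def refl_on_def)

lemma poset_trans: "(x, y) \<in> P \<Longrightarrow> (y, z) \<in> P \<Longrightarrow> (x, z) \<in> P"
  using P by (auto simp: finite_poset_def partial_order_on_def preorder_on_def elim: transE)

lemma poset_antisym: "(x, y) \<in> P \<Longrightarrow> (y, x) \<in> P \<Longrightarrow> x = y"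
  using P by (auto simp: finite_poset_def partial_order_on_def elim: antisymD)

lemma poset_finite: "finite (Field P)"
  using P by (simp add: finite_poset_def)

lemma finite_intervals: "finite (intervals P)"
  by (rule finite_subset[of _ "Pow (Field P)"]) (auto simp: intervals_def poset_finite)

lemma intervalD:
  assumes "I \<in> intervals P"
  shows "I \<subseteq> Field P" "I \<noteq> {}" "conn_in P I" "convex_in P I"
  using assms by (auto simp: intervals_def)

text \<open>An element of \<open>I\<close> below \<open>z\<close> with the fewest elements of
  \<open>I\<close> below it is minimal: another one beneath it would have fewer.\<close>

lemma sc_below:
  assumes I: "I \<subseteq> Field P" and z: "z \<in> I"
  shows "\<exists>a\<in>sc P I. (a, z) \<in> P"
proof -
  define d where "d w = card {u\<in>I. (u, w) \<in> P}" for w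
  have "z \<in> I \<and> (z, z) \<in> P" using z I poset_refl by blast
  then obtain a where a: "a \<in> I" "(a, z) \<in> P"
    and least: "\<And>w. w \<in> I \<and> (w, z) \<in> P \<Longrightarrow> d a \<le> d w"
    using ex_has_least_nat[of "\<lambda>w. w \<in> I \<and> (w, z) \<in> P" z d] by blast
  have "u = a" if u: "u \<in> I" "(u, a) \<in> P" for u
  proof (rule ccontr)
    assume "u \<noteq> a"
    then have "a \<notin> {w\<in>I. (w, u) \<in> P}" using u poset_antisym by blast
    moreover have "a \<in> {w\<in>I. (w, a) \<in> P}" using a(1) I poset_refl by blast
    moreover have "{w\<in>I. (w, u) \<in> P} \<subseteq> {w\<in>I. (w, a) \<in> P}" using u(2) poset_trans by blast
    ultimately have "{w\<in>I. (w, u) \<in> P} \<subset> {w\<in>I. (w, a) \<in> P}" by blast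
    moreover have "finite {w\<in>I. (w, a) \<in> P}"
      using finite_subset[OF I poset_finite] by simp
    ultimately have "d u < d a" unfolding d_def by (rule psubset_card_mono[rotated])
    moreover have "d a \<le> d u" using least[of u] u a(2) poset_trans by blast
    ultimately show False by simp
  qed
  then have "a \<in> sc P I" using a(1) by (simp add: sc_def)
  then show ?thesis using a(2) by blast
qed

lemma segment_interval:
  assumes xy: "(x, y) \<in> P"
  shows "segment P x y \<in> intervals P"
proof -
  have xF: "x \<in> Field P" using xy by (auto simp: Field_def)
  have x: "x \<in> segment P x y" using poset_refl[OF xF] xy by (simp add: segment_def)
  have "conn_in P (segment P x y)"
    unfolding conn_in_def
  proof (intro ballI)
    fix a b assume a: "a \<in> segment P x y" and b: "b \<in> segment P x y"
    let ?E = "(P \<union> P\<inverse>) \<inter> segment P x y \<times> segment P x y"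
    \<comment> \<open>Any two points are joined by a path through the bottom
      \<open>x\<close>.\<close>
    have "(a, x) \<in> ?E" "(x, b) \<in> ?E" using a b x by (auto simp: segment_def)
    then show "(a, b) \<in> ?E\<^sup>*" by (meson r_into_rtrancl rtrancl_trans)
  qed
  moreover have "convex_in P (segment P x y)"
    unfolding convex_in_def segment_def using poset_trans by blast
  moreover have "segment P x y \<subseteq> Field P" by (auto simp: segment_def Field_def)
  ultimately show ?thesis using x by (auto simp: intervals_def)
qed

text \<open>The join is the convex hull of the union. It is connected because each of its points
  lies above a point of some \<open>L\<close> in \<open>S\<close>, which is joined inside
  \<open>L\<close> to the common nonempty part \<open>J\<close>.\<close>

lemma join_exists:
  assumes J: "J \<in> intervals P" and S: "S \<subseteq> intervals P" "S \<noteq> {}" and JS: "\<And>L. L \<in> S \<Longrightarrow> J \<subseteq> L"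
  shows "\<exists>H. is_join P S H"
proof -
  define H where "H = {z. \<exists>a\<in>\<Union>S. \<exists>b\<in>\<Union>S. (a, z) \<in> P \<and> (z, b) \<in> P}"
  let ?E = "(P \<union> P\<inverse>) \<inter> H \<times> H"
  obtain j where j: "j \<in> J" using intervalD(2)[OF J] by blast
  have SF: "\<Union>S \<subseteq> Field P" using S intervalD(1) by blast
  have SH: "\<Union>S \<subseteq> H" using poset_refl SF unfolding H_def by blast
  have to_j: "(z, j) \<in> ?E\<^sup>*" if z: "z \<in> H" for z
  proof -
    obtain a L where a: "a \<in> L" "L \<in> S" "(a, z) \<in> P" using z unfolding H_def by blast
    have L: "L \<in> intervals P" using a(2) S by blast
    have "(a, j) \<in> ((P \<union> P\<inverse>) \<inter> L \<times> L)\<^sup>*"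
      using intervalD(3)[OF L] a JS[OF a(2)] j unfolding conn_in_def by blast
    moreover have "(P \<union> P\<inverse>) \<inter> L \<times> L \<subseteq> ?E" using SH a(2) by blast
    ultimately have "(a, j) \<in> ?E\<^sup>*" using rtrancl_mono by blast
    moreover have "(z, a) \<in> ?E" using z a SH by blast
    ultimately show ?thesis by (rule converse_rtrancl_into_rtrancl[rotated])
  qed
  have "sym ?E" by (auto simp: sym_def)
  then have sym: "sym (?E\<^sup>*)" by (rule sym_rtrancl)
  have "conn_in P H"
    unfolding conn_in_def
  proof (intro ballI)
    fix a b assume "a \<in> H" "b \<in> H"
    then show "(a, b) \<in> ?E\<^sup>*"
      using to_j symD[OF sym] by (blast intro: rtrancl_trans)
  qed
  moreover have "convex_in P H"
    unfolding convex_in_def H_def using poset_trans by blast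
  moreover have "H \<subseteq> Field P" by (auto simp: H_def Field_def)
  moreover have "H \<noteq> {}" using SH S(2) JS j by blast
  ultimately have "H \<in> intervals P" by (simp add: intervals_def)
  moreover have "H \<subseteq> K" if K: "K \<in> intervals P" "\<forall>L\<in>S. L \<subseteq> K" for K
  proof
    fix z assume "z \<in> H"
    then obtain a b where "a \<in> K" "b \<in> K" "(a, z) \<in> P" "(z, b) \<in> P"
      using K(2) unfolding H_def by blast
    then show "z \<in> K" using intervalD(4)[OF K(1)] unfolding convex_in_def by blast
  qed
  ultimately have "is_join P S H" using SH unfolding is_join_def by blast
  then show ?thesis by blast
qed

section \<open>Covers of an interval and their joins\<close>

lemma Cov_interval: "L \<in> Cov P J \<Longrightarrow> L \<in> intervals P" "L \<in> Cov P J \<Longrightarrow> J \<subset> L"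
  by (auto simp: Cov_def)

lemma join_is_join:
  assumes J: "J \<in> intervals P" and S: "S \<subseteq> Cov P J" "S \<noteq> {}"
  shows "is_join P S (join P J S)"
proof -
  have "\<exists>H. is_join P S H"
    by (rule join_exists[OF J _ S(2)]) (use S(1) in \<open>auto simp: Cov_def\<close>)
  moreover have "H = K" if "is_join P S H" "is_join P S K" for H K
    using that unfolding is_join_def by (simp add: subset_antisym)
  ultimately have "\<exists>!H. is_join P S H" by blast
  then have "is_join P S (THE H. is_join P S H)" by (rule theI')
  then show ?thesis using S(2) by (simp add: join_def)
qed

lemma join_subset_iff:
  assumes J: "J \<in> intervals P" and S: "S \<subseteq> Cov P J" "S \<noteq> {}" and K: "K \<in> intervals P"
  shows "join P J S \<subseteq> K \<longleftrightarrow> (\<forall>L\<in>S. L \<subseteq> K)"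
  using join_is_join[OF J S] K unfolding is_join_def by blast

lemma join_gt:
  assumes J: "J \<in> intervals P" and S: "S \<subseteq> Cov P J" "S \<noteq> {}"
  shows "join P J S \<in> intervals P" "J \<subset> join P J S"
proof -
  have j: "is_join P S (join P J S)" by (rule join_is_join[OF assms])
  then show "join P J S \<in> intervals P" by (simp add: is_join_def)
  obtain L where L: "L \<in> S" using S(2) by blast
  then have "J \<subset> L" "L \<subseteq> join P J S" using Cov_interval(2) S(1) j by (auto simp: is_join_def)
  then show "J \<subset> join P J S" by (rule psubset_subset_trans)
qed

text \<open>Among the finitely many intervals strictly above \<open>J\<close> and inside
  \<open>K\<close>, a minimal one is a cover of \<open>J\<close>.\<close>

lemma Cov_below:
  assumes K: "K \<in> intervals P" and JK: "J \<subset> K"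
  shows "\<exists>L\<in>Cov P J. L \<subseteq> K"
proof -
  let ?T = "{L \<in> intervals P. J \<subset> L \<and> L \<subseteq> K}"
  have "finite ?T" using finite_intervals by simp
  moreover have "?T \<noteq> {}" using K JK by blast
  ultimately have "\<exists>L\<in>?T. \<forall>L'\<in>?T. L' \<subseteq> L \<longrightarrow> L = L'" by (rule finite_has_minimal)
  then obtain L where LT: "L \<in> ?T" and min: "\<forall>L'\<in>?T. L' \<subseteq> L \<longrightarrow> L = L'" by (rule bexE)
  have L: "L \<in> intervals P" "J \<subset> L" "L \<subseteq> K" using LT by simp_all
  have "\<not> (\<exists>L'\<in>intervals P. J \<subset> L' \<and> L' \<subset> L)"
  proof
    assume "\<exists>L'\<in>intervals P. J \<subset> L' \<and> L' \<subset> L"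
    then obtain L' where L': "L' \<in> intervals P" "J \<subset> L'" "L' \<subset> L" by blast
    then have "L = L'" using min L(3) by simp
    then show False using L'(3) by blast
  qed
  then have "L \<in> Cov P J" using L by (simp add: Cov_def)
  then show ?thesis using L(3) by blast
qed

end

text \<open>Maximal elements are the minimal elements of the opposite poset.\<close>

lemma sk_above:
  assumes P: "finite_poset P" and I: "I \<subseteq> Field P" and z: "z \<in> I"
  shows "\<exists>b\<in>sk P I. (z, b) \<in> P"
proof -
  have "finite_poset (P\<inverse>)"
    using P by (auto simp: finite_poset_def partial_order_on_def preorder_on_def intro: FieldI1 FieldI2)
  moreover have "sk P I = sc (P\<inverse>) I" by (auto simp: sk_def sc_def)
  ultimately show ?thesis using sc_below[of "P\<inverse>" I z] I z by auto
qed

section \<open>Inversion of sums over larger intervals\<close>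

lemma sum_Pow_alternating:
  assumes "finite X"
  shows "(\<Sum>S\<in>Pow X. (- 1) ^ card S) = (if X = {} then 1 else (0::int))"
  using assms
proof (induction X)
  case (insert x X)
  \<comment> \<open>Subsets containing \<open>x\<close> correspond to those without it, with the
    opposite sign, so the two halves of the sum cancel.\<close>
  have inj: "inj_on (insert x) (Pow X)" using insert.hyps(2) by (auto simp: inj_on_def)
  have "(\<Sum>S\<in>Pow (insert x X). (- 1) ^ card S) =
      (\<Sum>S\<in>Pow X. (- 1) ^ card S) + (\<Sum>S\<in>insert x ` Pow X. (- 1) ^ card S :: int)"
    unfolding Pow_insert using insert.hyps by (intro sum.union_disjoint) auto
  also have "(\<Sum>S\<in>insert x ` Pow X. (- 1) ^ card S) = (\<Sum>S\<in>Pow X. - ((- 1) ^ card S) :: int)"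
    unfolding sum.reindex[OF inj] o_def
  proof (rule sum.cong[OF refl])
    fix S assume S: "S \<in> Pow X"
    then have "finite S" "x \<notin> S" using insert.hyps finite_subset by auto
    then show "(- 1) ^ card (insert x S) = - ((- 1) ^ card S :: int)" by simp
  qed
  finally show ?case by (simp add: sum_negf)
qed simp

text \<open>By downward induction on \<open>J\<close>: the value of \<open>c\<close> at the join of a nonempty \<open>S\<close> is already
  expanded, and the signs of the \<open>S\<close> whose join lies below a given \<open>K\<close> add up to \<open>- 1\<close>.\<close>

lemma cover_join_inversion:
  fixes c \<delta> :: "'p set \<Rightarrow> int"
  assumes P: "finite_poset P" and J: "J \<in> intervals P"
    and \<delta>: "\<And>K. \<delta> K = (\<Sum>S\<in>Pow (Cov P K). (- 1) ^ card S * c (join P K S))"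
  shows "(\<Sum>K\<in>{K\<in>intervals P. J \<subseteq> K}. \<delta> K) = c J"
  using J
proof (induction "card (Field P) - card J" arbitrary: J rule: less_induct)
  case (less J)
  note J = less.prems
  let ?I = "intervals P" and ?C = "Cov P J"
  have finI: "finite ?I" by (rule finite_intervals[OF P])
  have finC: "finite ?C" by (rule finite_subset[OF _ finI]) (auto simp: Cov_def)
  have IH: "c (join P J S) = (\<Sum>K\<in>{K\<in>?I. join P J S \<subseteq> K}. \<delta> K)"
    if S: "S \<subseteq> ?C" "S \<noteq> {}" for S
  proof -
    note g = join_gt[OF P J S]
    have F: "join P J S \<subseteq> Field P" using intervalD(1)[OF P g(1)] .
    have "card J < card (join P J S)"
      using psubset_card_mono[OF finite_subset[OF F poset_finite[OF P]] g(2)] .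
    moreover have "card (join P J S) \<le> card (Field P)" using card_mono[OF poset_finite[OF P] F] .
    ultimately show ?thesis by (intro less.hyps[symmetric] g(1)) simp
  qed
  \<comment> \<open>By the universal property of joins, \<open>S\<close> runs over the nonempty sets
    of covers of \<open>J\<close> inside \<open>K\<close>. Such covers exist exactly when
    \<open>J \<subset> K\<close>; the alternating sum over all sets of them is then 0, and otherwise
    it is 1. Removing the empty set subtracts 1.\<close>
  have sgn: "(\<Sum>S\<in>{S\<in>Pow ?C - {{}}. join P J S \<subseteq> K}. (- 1) ^ card S) = (if J \<subset> K then - 1 else (0::int))"
    if K: "K \<in> ?I" for K
  proof -
    let ?CK = "{L\<in>?C. L \<subseteq> K}"
    have fCK: "finite ?CK" using finC by simp
    have "{S\<in>Pow ?C - {{}}. join P J S \<subseteq> K} = Pow ?CK - {{}}"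
    proof (rule set_eqI)
      fix S
      show "S \<in> {S\<in>Pow ?C - {{}}. join P J S \<subseteq> K} \<longleftrightarrow> S \<in> Pow ?CK - {{}}"
      proof (cases "S \<subseteq> ?C \<and> S \<noteq> {}")
        case True
        then have "join P J S \<subseteq> K \<longleftrightarrow> (\<forall>L\<in>S. L \<subseteq> K)" using join_subset_iff[OF P J _ _ K] by simp
        then show ?thesis using True by auto
      next
        case False
        then show ?thesis by auto
      qed
    qed
    then have "(\<Sum>S\<in>{S\<in>Pow ?C - {{}}. join P J S \<subseteq> K}. (- 1) ^ card S) =
        (\<Sum>S\<in>Pow ?CK. (- 1) ^ card S) - (1::int)"
      using fCK by (simp add: sum_diff1)
    also have "\<dots> = (if J \<subset> K then - 1 else 0)"
    proof (cases "J \<subset> K")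
      case True
      then have "?CK \<noteq> {}" using Cov_below[OF P K] by blast
      then show ?thesis unfolding sum_Pow_alternating[OF fCK] using True by simp
    next
      case False
      then have "?CK = {}" using Cov_interval(2)[OF P] by blast
      then show ?thesis unfolding sum_Pow_alternating[OF fCK] using False by simp
    qed
    finally show ?thesis .
  qed
  \<comment> \<open>The empty set of covers contributes \<open>c J\<close>, because its join is
    \<open>J\<close> by convention.\<close>
  have "\<delta> J = c J + (\<Sum>S\<in>Pow ?C - {{}}. (- 1) ^ card S * c (join P J S))"
    unfolding \<delta> using finC by (subst sum.remove[of _ "{}"]) (auto simp: join_def)
  also have "(\<Sum>S\<in>Pow ?C - {{}}. (- 1) ^ card S * c (join P J S)) =
      (\<Sum>S\<in>Pow ?C - {{}}. \<Sum>K\<in>{K\<in>?I. join P J S \<subseteq> K}. (- 1) ^ card S * \<delta> K)"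
    by (rule sum.cong[OF refl]) (use IH in \<open>auto simp: sum_distrib_left\<close>)
  \<comment> \<open>Exchanging the sums collects, for each \<open>K\<close>, the signs of all
    \<open>S\<close> whose join lies in \<open>K\<close>.\<close>
  also have "\<dots> = (\<Sum>K\<in>?I. \<Sum>S\<in>{S\<in>Pow ?C - {{}}. join P J S \<subseteq> K}. (- 1) ^ card S * \<delta> K)"
    by (rule sum.swap_restrict) (use finC finI in auto)
  also have "\<dots> = (\<Sum>K\<in>?I. if J \<subset> K then - \<delta> K else 0)"
  proof (rule sum.cong[OF refl])
    fix K assume "K \<in> ?I"
    then show "(\<Sum>S\<in>{S\<in>Pow ?C - {{}}. join P J S \<subseteq> K}. (- 1) ^ card S * \<delta> K) =
        (if J \<subset> K then - \<delta> K else 0)"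
      unfolding sum_distrib_right[symmetric] by (simp only: sgn) simp
  qed
  also have "\<dots> = (\<Sum>K\<in>{K\<in>?I. J \<subset> K}. - \<delta> K)"
    using finI by (simp add: sum.inter_filter)
  finally have "c J = \<delta> J + (\<Sum>K\<in>{K\<in>?I. J \<subset> K}. \<delta> K)" by (simp add: sum_negf)
  also have "\<dots> = (\<Sum>K\<in>insert J {K\<in>?I. J \<subset> K}. \<delta> K)" using finI by simp
  also have "insert J {K\<in>?I. J \<subset> K} = {K\<in>?I. J \<subseteq> K}" using J by blast
  finally show ?case by simp
qed

section \<open>Ranks of modules and of interval sums\<close>

lemma monotone_Field:
  assumes "\<forall>(a, b)\<in>r. (f a, f b) \<in> P" "a \<in> Field r"
  shows "f a \<in> Field P"
  using assms unfolding Field_def by fast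

text \<open>An order-preserving map carries morphisms to morphisms with the same coefficient, so
  each axiom is the one for \<open>M\<close> at the image points.\<close>

lemma pullback_is_mod:
  assumes M: "is_mod P M" and f: "\<forall>(a, b)\<in>r. (f a, f b) \<in> P"
  shows "is_mod r (pullback f M)"
proof -
  have F: "f a \<in> Field P" if "a \<in> Field r" for a using monotone_Field[OF f that] .
  have h: "c \<in> inc_hom P (f a) (f b)" if "c \<in> inc_hom r a b" for c :: 'b and a b
    using that f by (auto simp: inc_hom_def split: if_splits)
  show ?thesis
    unfolding is_mod_def pullback_def rep.select_convs
  proof (intro conjI)
    show "vector_space (scl M)" by (rule is_modD(1)[OF M])
  qed (use F h is_modD(2-)[OF M] in simp_all)
qed

lemma R_simps:
  "scl (R \<xi> I M) = scl M" "obj (R \<xi> I M) a = obj M (cmap \<xi> I a)"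
  "act (R \<xi> I M) a b = act M (cmap \<xi> I a) (cmap \<xi> I b)"
  by (simp_all add: R_def pullback_def)

lemma seg_rank_spec:
  assumes M: "is_mod P M" and xy: "(x, y) \<in> P"
  obtains B where "finite B" "card B = seg_rank M x y"
    "module.span (scl M) B = act M x y 1 ` obj M x" "\<not> module.dependent (scl M) B"
proof -
  interpret vector_space "scl M" by (rule mod_vector_space[OF M])
  have x: "x \<in> Field P" and y: "y \<in> Field P" using xy by (auto simp: Field_def)
  let ?U = "act M x y 1 ` obj M x"
  note add = mod_act_add[OF M xy] and sc = mod_act_scl[OF M xy]
  have "subspace ?U"
  proof (rule subspaceI)
    show "0 \<in> ?U"
      using linear_between_zero[OF mod_act_linear[OF M xy] mod_zero_mem[OF M x], of 1] mod_zero_mem[OF M x]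
      by (intro image_eqI[of _ _ 0]) simp_all
    show "u + v \<in> ?U" if uv: "u \<in> ?U" "v \<in> ?U" for u v
    proof -
      obtain a b where ab: "a \<in> obj M x" "b \<in> obj M x" "u = act M x y 1 a" "v = act M x y 1 b"
        using uv by blast
      then have "u + v = act M x y 1 (a + b)" using add by simp
      then show ?thesis using mod_add_mem[OF M x ab(1,2)] by (rule image_eqI)
    qed
    show "scl M a u \<in> ?U" if u: "u \<in> ?U" for a u
    proof -
      obtain b where b: "b \<in> obj M x" "u = act M x y 1 b" using u by blast
      then have "scl M a u = act M x y 1 (scl M a b)" using sc by simp
      then show ?thesis using mod_scl_mem[OF M x b(1)] by (rule image_eqI)
    qed
  qed
  moreover obtain F where "finite F" "span F = obj M y" using mod_finite_span[OF M y] by blast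
  moreover have "?U \<subseteq> obj M y" using mod_act_closed[OF M xy] by blast
  ultimately show thesis
    using finite_basis_of_subspace[of ?U F] that unfolding seg_rank_def by metis
qed

lemma mod_dim_eq_seg_rank:
  assumes "is_mod P N" "x \<in> Field P"
  shows "mod_dim N x = seg_rank N x x"
proof -
  have "act N x x 1 ` obj N x = obj N x" using mod_act_id[OF assms] by simp
  then show ?thesis by (simp add: mod_dim_def seg_rank_def)
qed

section \<open>Compression ranks read off from dual systems\<close>

context
  fixes P :: "'p rel" and \<xi> :: "('p, 'q) compression"
  assumes P: "finite_poset P" and \<xi>: "rank_compression_system P \<xi>"
begin

lemma compressionD:
  assumes I: "I \<in> intervals P"
  shows "finite (Field (shape \<xi> I))" "Field (shape \<xi> I) \<noteq> {}"
    "conn_in (shape \<xi> I) (Field (shape \<xi> I))"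
    "\<forall>(a, b)\<in>shape \<xi> I. (cmap \<xi> I a, cmap \<xi> I b) \<in> P"
    "cmap \<xi> I ` Field (shape \<xi> I) \<subseteq> I"
    "sc P I \<union> sk P I \<subseteq> cmap \<xi> I ` Field (shape \<xi> I)"
    "(x, y) \<in> P \<Longrightarrow> I = segment P x y \<Longrightarrow>
      \<exists>(x', y')\<in>shape \<xi> I. cmap \<xi> I x' = x \<and> cmap \<xi> I y' = y"
  by (insert bspec[OF \<xi>[unfolded rank_compression_system_def] I], unfold finite_poset_def)
    (elim conjE; blast)+

text \<open>Since \<open>cmap \<xi> I\<close> maps into \<open>I\<close>, pulling back the interval
  module of \<open>I\<close> gives a constant module. Computing a compression rank thus amounts to
  exhibiting a dual system.\<close>

lemma comp_rank_eq_card: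
  fixes M :: "('p, 'k::field, 'v::ab_group_add) rep"
  assumes I: "I \<in> intervals P" and M: "is_mod P M"
    and B: "dual_system (shape \<xi> I) (R \<xi> I M) B \<sigma> \<theta>"
  shows "comp_rank \<xi> I M = card B"
proof -
  note c = compressionD[OF I]
  have "constant_on (shape \<xi> I) (R \<xi> I (interval_module I :: ('p, 'k, 'k) rep))"
    unfolding constant_on_def R_simps using c(5) by (simp add: interval_module_def image_subset_iff)
  moreover have "is_mod (shape \<xi> I) (R \<xi> I M)"
    unfolding R_def by (rule pullback_is_mod[OF M c(4)])
  ultimately show ?thesis
    unfolding comp_rank_def using multiplicity_constant_eq_card c(1,3) B by blast
qed

text \<open>The dual system is indexed by a basis \<open>B\<close> of the image of M(x) in M(y).
  Every section takes a value in this image at the point \<open>y'\<close> over \<open>y\<close>, so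
  nothing else enters the pairing.\<close>

lemma comp_rank_segment:
  fixes M :: "('p, 'k::field, 'v::ab_group_add) rep"
  assumes M: "is_mod P M" and xy: "(x, y) \<in> P"
  shows "comp_rank \<xi> (segment P x y) M = seg_rank M x y"
proof -
  interpret vector_space "scl M" by (rule mod_vector_space[OF M])
  define I where "I = segment P x y"
  have I: "I \<in> intervals P" unfolding I_def by (rule segment_interval[OF P xy])
  note c = compressionD[OF I]
  let ?Q = "shape \<xi> I" and ?f = "cmap \<xi> I"
  have xF: "x \<in> Field P" and yF: "y \<in> Field P" using xy by (auto simp: Field_def)
  have "\<exists>(x', y')\<in>?Q. ?f x' = x \<and> ?f y' = y" by (rule c(7)[OF xy I_def])
  then obtain x' y' where x'y': "(x', y') \<in> ?Q" and fx: "?f x' = x" and fy: "?f y' = y" by blast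
  have x'Q: "x' \<in> Field ?Q" and y'Q: "y' \<in> Field ?Q" using x'y' by (auto simp: Field_def)
  have bet: "(x, ?f a) \<in> P" "(?f a, y) \<in> P" if "a \<in> Field ?Q" for a
    using c(5) that by (auto simp: I_def segment_def)
  have mono: "(?f a, ?f b) \<in> P" if "(a, b) \<in> ?Q" for a b using c(4) that by blast
  obtain B where B: "finite B" "card B = seg_rank M x y" "span B = act M x y 1 ` obj M x"
    "independent B" using seg_rank_spec[OF M xy] by blast
  have "\<forall>b\<in>B. \<exists>v. v \<in> obj M x \<and> act M x y 1 v = b"
  proof
    fix b assume "b \<in> B"
    then have "b \<in> act M x y 1 ` obj M x" unfolding B(3)[symmetric] by (rule span_base)
    then show "\<exists>v. v \<in> obj M x \<and> act M x y 1 v = b" by (elim imageE) auto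
  qed
  then obtain v where v: "\<forall>b\<in>B. v b \<in> obj M x \<and> act M x y 1 (v b) = b"
    by (rule bchoice[THEN exE])
  \<comment> \<open>The coordinates at \<open>B\<close> are needed on all of \<open>obj M y\<close>
    and not only on the image; a basis of the whole space extending \<open>B\<close> provides them
    as functionals.\<close>
  define E where "E = extend_basis B"
  have E: "B \<subseteq> E" "independent E" "span E = UNIV"
    using B(4) by (simp_all add: E_def extend_basis_superset independent_extend_basis)
  define \<psi> where "\<psi> b w = representation E w b" for b w
  have \<psi>: "\<psi> b (u + w) = \<psi> b u + \<psi> b w" "\<psi> b (scl M a w) = a * \<psi> b w" for a b u w
    by (simp_all add: \<psi>_def representation_add[OF E(2)] representation_scale[OF E(2)] E(3))
  have \<psi>_B: "\<psi> i j = (if i = j then 1 else 0)" if "i \<in> B" "j \<in> B" for i j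
    using representation_basis[OF E(2), of j] E(1) that by (auto simp: \<psi>_def)
  have \<psi>_sum: "(\<Sum>b\<in>B. scl M (\<psi> b u) b) = u" if "u \<in> span B" for u
    unfolding \<psi>_def representation_extend[OF E(2) that E(1)]
    by (rule sum_representation_eq[OF B(4) that B(1)]) simp
  \<comment> \<open>The section spreads a preimage of \<open>b\<close> from the bottom
    \<open>x\<close> over the segment; the cosection pushes every element to the top
    \<open>y\<close> and reads its coordinate at \<open>b\<close>.\<close>
  define \<sigma> where "\<sigma> b a = act M x (?f a) 1 (v b)" for b a
  define \<theta> where "\<theta> b a w = \<psi> b (act M (?f a) y 1 w)" for b a w
  have \<sigma>y: "\<sigma> b y' = b" if "b \<in> B" for b using v that by (simp add: \<sigma>_def fy)
  have \<theta>y: "\<theta> b y' w = \<psi> b w" if "w \<in> obj M y" for b w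
    using mod_act_id[OF M yF that] by (simp add: \<theta>_def fy)
  have B_obj: "b \<in> obj M y" if "b \<in> B" for b using mod_act_closed[OF M xy, of "v b" 1] v that by simp
  have "dual_system ?Q (R \<xi> I M) B \<sigma> \<theta>"
    unfolding dual_system_def
  proof (intro conjI ballI bexI[of _ y'] allI impI)
    show "finite B" by (rule B(1))
    show "y' \<in> Field ?Q" by (rule y'Q)
    fix b assume b: "b \<in> B"
    have vb: "v b \<in> obj M x" using v b by blast
    show "is_section ?Q (R \<xi> I M) (\<sigma> b)"
      unfolding is_section_def R_simps \<sigma>_def
    proof (intro conjI ballI allI impI)
      show "act M x (?f a) 1 (v b) \<in> obj M (?f a)" if "a \<in> Field ?Q" for a
        by (rule mod_act_closed[OF M bet(1)[OF that] vb])
      show "act M (?f a) (?f a') 1 (act M x (?f a) 1 (v b)) = act M x (?f a') 1 (v b)"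
        if "(a, a') \<in> ?Q" for a a'
        by (rule mod_act_comp[OF M bet(1) mono[OF that] vb]) (use that in \<open>auto simp: Field_def\<close>)
    qed
    show "is_cosection ?Q (R \<xi> I M) (\<theta> b)"
      unfolding is_cosection_def R_simps \<theta>_def
    proof (intro conjI ballI allI impI)
      show "linear_between (scl M) (*) (obj M (?f a)) UNIV (\<lambda>w. \<psi> b (act M (?f a) y 1 w))"
        if "a \<in> Field ?Q" for a
        unfolding linear_between_def
        using mod_act_add[OF M bet(2)[OF that]] mod_act_scl[OF M bet(2)[OF that]] \<psi> by simp
      fix a a' w assume h: "(a, a') \<in> ?Q \<and> w \<in> obj M (?f a)"
      then have "a' \<in> Field ?Q" by (auto simp: Field_def)
      then show "\<psi> b (act M (?f a') y 1 (act M (?f a) (?f a') 1 w)) = \<psi> b (act M (?f a) y 1 w)"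
        using mod_act_comp[OF M mono bet(2), of a a' w] h by simp
    qed
    show "\<theta> b y' (\<sigma> j y') = (if b = j then 1 else 0)" if "j \<in> B" for j
      using \<psi>_B[OF b that] \<sigma>y[OF that] \<theta>y[OF B_obj[OF that]] by simp
  next
    fix s \<phi> assume "is_section ?Q (R \<xi> I M) s \<and> is_cosection ?Q (R \<xi> I M) \<phi>"
    then have s: "\<forall>a\<in>Field ?Q. s a \<in> obj M (?f a)"
        "\<forall>a b. (a, b) \<in> ?Q \<longrightarrow> act M (?f a) (?f b) 1 (s a) = s b"
      and \<phi>: "\<forall>a\<in>Field ?Q. linear_between (scl M) (*) (obj M (?f a)) UNIV (\<phi> a)"
      by (simp_all add: is_section_def is_cosection_def R_simps)
    have lin: "linear_between (scl M) (*) (obj M y) UNIV (\<phi> y')" using \<phi> y'Q fy by blast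
    \<comment> \<open>Condition (3) on compression systems enters here: \<open>x' \<le> y'\<close>
      lie over the two endpoints, so the value at \<open>y'\<close> is the image of the value at
      \<open>x'\<close>.\<close>
    have "s y' = act M x y 1 (s x')" using s(2) x'y' fx fy by metis
    moreover have "s x' \<in> obj M x" using s(1) x'Q fx by blast
    ultimately have sU: "s y' \<in> span B" unfolding B(3) by (rule image_eqI)
    have sy: "s y' \<in> obj M y" using s(1) y'Q fy by blast
    have "\<phi> y' (s y') = \<phi> y' (\<Sum>b\<in>B. scl M (\<psi> b (s y')) b)"
      using \<psi>_sum[OF sU] by simp
    also have "\<dots> = (\<Sum>b\<in>B. \<phi> y' (scl M (\<psi> b (s y')) b))"
      by (rule linear_between_sum[OF lin mod_vector_space[OF M] mod_subspace[OF M yF]])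
        (rule mod_scl_mem[OF M yF B_obj])
    also have "\<dots> = (\<Sum>b\<in>B. \<phi> y' (\<sigma> b y') * \<theta> b y' (s y'))"
      by (rule sum.cong[OF refl])
        (simp add: linear_between_scl[OF lin B_obj] \<sigma>y \<theta>y[OF sy])
    finally show "\<phi> y' (s y') = (\<Sum>b\<in>B. \<phi> y' (\<sigma> b y') * \<theta> b y' (s y'))" .
  qed
  from comp_rank_eq_card[OF I M this] B(2) show ?thesis by (simp add: I_def)
qed

end

section \<open>Direct sums of interval modules\<close>

definition summands :: "'p rel \<Rightarrow> ('p set \<Rightarrow> int) \<Rightarrow> ('p set \<times> nat) set" where
  "summands P m = {l. fst l \<in> intervals P \<and> snd l < nat (m (fst l))}"

text \<open>Vanishing outside the index set and vanishing outside the interval merge into one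
  support condition on coefficient functions, so that later computations are coordinatewise.\<close>

lemma interval_sum_simps:
  "scl (interval_sum P m :: ('p, 'k::field, 'p set \<times> nat \<Rightarrow> 'k) rep) = (\<lambda>a u l. a * u l)"
  "u \<in> obj (interval_sum P m :: ('p, 'k, 'p set \<times> nat \<Rightarrow> 'k) rep) x \<longleftrightarrow>
    (\<forall>l. \<not> (l \<in> summands P m \<and> x \<in> fst l) \<longrightarrow> u l = 0)"
  "act (interval_sum P m :: ('p, 'k, 'p set \<times> nat \<Rightarrow> 'k) rep) x y c u =
    (\<lambda>l. if l \<in> summands P m \<and> x \<in> fst l \<and> y \<in> fst l then c * u l else 0)"
  by (auto simp: interval_sum_def direct_sum_def interval_module_def summands_def fun_eq_iff
      split: prod.splits if_splits)

lemma finite_summands: "finite_poset P \<Longrightarrow> finite (summands P m)"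
  by (rule finite_subset[of _ "SIGMA I:intervals P. {..<nat (m I)}"])
    (auto simp: summands_def finite_intervals)

definition unit_fun :: "'i \<Rightarrow> 'i \<Rightarrow> 'k::field" where
  "unit_fun l = (\<lambda>i. if i = l then 1 else 0)"

lemma sum_unit_fun:
  assumes "finite A" "\<And>l. u l \<noteq> 0 \<Longrightarrow> l \<in> A"
  shows "(\<Sum>l\<in>A. (\<lambda>i. u l * unit_fun l i)) = (u :: 'i \<Rightarrow> 'k::field)"
proof
  fix i
  have "(\<Sum>l\<in>A. u l * unit_fun l i) = (\<Sum>l\<in>A. if i = l then u l else 0)"
    by (rule sum.cong) (simp_all add: unit_fun_def)
  also have "\<dots> = u i" using assms by auto
  finally show "(\<Sum>l\<in>A. (\<lambda>i. u l * unit_fun l i)) i = u i" by (simp add: sum_fun_apply)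
qed

lemma interval_sum_is_mod:
  fixes m :: "'p set \<Rightarrow> int"
  assumes P: "finite_poset P"
  shows "is_mod P (interval_sum P m :: ('p, 'k::field, 'p set \<times> nat \<Rightarrow> 'k) rep)" (is "is_mod P ?N")
proof -
  interpret V: vector_space "\<lambda>(a::'k) (u :: 'p set \<times> nat \<Rightarrow> 'k) l. a * u l"
    by unfold_locales (auto simp: algebra_simps fun_eq_iff)
  let ?A = "summands P m"
  have sub: "V.subspace (obj ?N x)" for x
    by (rule V.subspaceI) (simp_all add: interval_sum_simps)
  have span: "\<exists>B. finite B \<and> V.span B = obj ?N x" for x
  proof (intro exI[of _ "unit_fun ` {l\<in>?A. x \<in> fst l}"] conjI subset_antisym)
    show "finite (unit_fun ` {l\<in>?A. x \<in> fst l} :: ('p set \<times> nat \<Rightarrow> 'k) set)"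
      using finite_summands[OF P] by simp
    show "V.span (unit_fun ` {l\<in>?A. x \<in> fst l}) \<subseteq> obj ?N x"
      by (rule V.span_minimal[OF _ sub]) (auto simp: interval_sum_simps unit_fun_def split: if_splits)
    show "obj ?N x \<subseteq> V.span (unit_fun ` {l\<in>?A. x \<in> fst l})"
    proof
      fix u assume u: "u \<in> obj ?N x"
      have "(\<Sum>l\<in>{l\<in>?A. x \<in> fst l}. (\<lambda>i. u l * unit_fun l i)) = u"
      proof (rule sum_unit_fun)
        show "finite {l\<in>?A. x \<in> fst l}" using finite_summands[OF P] by simp
        show "l \<in> {l\<in>?A. x \<in> fst l}" if "u l \<noteq> 0" for l
          using u that unfolding interval_sum_simps(2) by blast
      qed
      moreover have "(\<lambda>i. u l * unit_fun l i) \<in> V.span (unit_fun ` {l\<in>?A. x \<in> fst l})"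
        if "l \<in> {l\<in>?A. x \<in> fst l}" for l
        by (rule V.span_scale) (rule V.span_base[OF imageI[OF that]])
      ultimately show "u \<in> V.span (unit_fun ` {l\<in>?A. x \<in> fst l})"
        by (metis (no_types, lifting) V.span_sum)
    qed
  qed
  show ?thesis
    unfolding is_mod_def interval_sum_simps(1)
  proof (intro conjI ballI allI)
    show "vector_space (\<lambda>(a::'k) (u :: 'p set \<times> nat \<Rightarrow> 'k) l. a * u l)"
      by (rule V.vector_space_axioms)
    show "V.subspace (obj ?N x)" for x by (rule sub)
    show "\<exists>B. finite B \<and> V.span B = obj ?N x" for x by (rule span)
    show "linear_between (\<lambda>a u l. a * u l) (\<lambda>a u l. a * u l) (obj ?N x) (obj ?N y) (act ?N x y c)"
      for x y c
      by (simp add: linear_between_def interval_sum_simps fun_eq_iff distrib_left mult.left_commute)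
    show "act ?N x x 1 u = u" if "u \<in> obj ?N x" for x u
      using that by (intro ext) (simp add: interval_sum_simps del: split_paired_All)
    show "act ?N x z (d * c) u = act ?N y z d (act ?N x y c u)"
      if c: "c \<in> inc_hom P x y" and d: "d \<in> inc_hom P y z" for x y z c d u
    proof -
      \<comment> \<open>Functoriality rests on convexity: if \<open>x \<le> y \<le> z\<close> with
        both ends in the interval, then \<open>y\<close> is in it as well; if one of the relations
        fails, its coefficient is 0.\<close>
      have "d * c = 0 \<or> y \<in> fst l" if l: "l \<in> ?A" "x \<in> fst l" "z \<in> fst l" for l
      proof (cases "(x, y) \<in> P \<and> (y, z) \<in> P")
        case True
        have "convex_in P (fst l)" using intervalD(4)[OF P] l(1) by (simp add: summands_def)
        then show ?thesis using True l unfolding convex_in_def by blast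
      next
        case False
        then show ?thesis using c d by (auto simp: inc_hom_def split: if_splits)
      qed
      then show ?thesis by (intro ext) (auto simp: interval_sum_simps)
    qed
    show "act ?N x y (c + d) u = act ?N x y c u + act ?N x y d u" for x y c d u
      by (intro ext) (simp add: interval_sum_simps distrib_right)
    show "act ?N x y (a * c) u = (\<lambda>l. a * act ?N x y c u l)" for x y a c u
      by (intro ext) (simp add: interval_sum_simps mult.assoc)
  qed
qed

text \<open>The summands whose interval contains \<open>I\<close> restrict to copies of the constant
  module, and their unit functions and coordinates form a dual system. The other summands contribute
  nothing to any pairing.\<close>

lemma comp_rank_interval_sum:
  fixes m :: "'p set \<Rightarrow> int"
  assumes P: "finite_poset P" and \<xi>: "rank_compression_system P \<xi>" and I: "I \<in> intervals P"
  shows "comp_rank \<xi> I (interval_sum P m :: ('p, 'k::field, 'p set \<times> nat \<Rightarrow> 'k) rep) =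
    card {l \<in> summands P m. I \<subseteq> fst l}"
proof -
  let ?N = "interval_sum P m :: ('p, 'k, 'p set \<times> nat \<Rightarrow> 'k) rep"
  let ?A = "summands P m" and ?B = "{l \<in> summands P m. I \<subseteq> fst l}"
  let ?Q = "shape \<xi> I" and ?f = "cmap \<xi> I"
  note c = compressionD[OF P \<xi> I]
  have fin: "finite ?A" by (rule finite_summands[OF P])
  have fI: "?f a \<in> I" if "a \<in> Field ?Q" for a using c(5) that by blast
  obtain q where q: "q \<in> Field ?Q" using c(2) by blast
  note rs = R_simps[of \<xi> I ?N] interval_sum_simps
  have "dual_system ?Q (R \<xi> I ?N) ?B (\<lambda>l a. unit_fun l) (\<lambda>l a u. u l)"
    unfolding dual_system_def
  proof (intro conjI ballI bexI[of _ q] allI impI)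
    show "finite ?B" using fin by simp
    show "q \<in> Field ?Q" by (rule q)
    fix l assume l: "l \<in> ?B"
    have fl: "?f a \<in> fst l" if "a \<in> Field ?Q" for a using fI[OF that] l by blast
    have fl': "?f a \<in> fst l" "?f b \<in> fst l" if "(a, b) \<in> ?Q" for a b
      using fl that by (auto simp: Field_def)
    show "is_section ?Q (R \<xi> I ?N) (\<lambda>a. unit_fun l)"
      unfolding is_section_def rs using l fl fl' by (auto simp: unit_fun_def fun_eq_iff)
    show "is_cosection ?Q (R \<xi> I ?N) (\<lambda>a u. u l)"
      unfolding is_cosection_def rs linear_between_def using l fl' by auto
    show "unit_fun j l = (if l = j then 1 else 0)" for j by (simp add: unit_fun_def)
  next
    fix s \<phi> assume "is_section ?Q (R \<xi> I ?N) s \<and> is_cosection ?Q (R \<xi> I ?N) \<phi>"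
    then have s: "is_section ?Q (R \<xi> I ?N) s" and \<phi>: "is_cosection ?Q (R \<xi> I ?N) \<phi>" by simp_all
    \<comment> \<open>The component of \<open>s\<close> in the summand \<open>l\<close>. It is again
      a section, so its pairing with \<open>\<phi>\<close> is the same at every point.\<close>
    define t where "t l a = (\<lambda>i. s a l * unit_fun l i)" for l a
    have sm: "\<forall>l. \<not> (l \<in> ?A \<and> ?f a \<in> fst l) \<longrightarrow> s a l = 0" if "a \<in> Field ?Q" for a
      using s that by (simp add: is_section_def rs)
    have N: "is_mod ?Q (R \<xi> I ?N)"
      unfolding R_def by (rule pullback_is_mod[OF interval_sum_is_mod[OF P] c(4)])
    have t: "is_section ?Q (R \<xi> I ?N) (t l)" for l
      unfolding is_section_def rs
    proof (intro conjI ballI)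
      show "\<forall>i. \<not> (i \<in> ?A \<and> ?f a \<in> fst i) \<longrightarrow> t l a i = 0" if "a \<in> Field ?Q" for a
        using sm[OF that] by (auto simp: t_def unit_fun_def)
      show "\<forall>a b. (a, b) \<in> ?Q \<longrightarrow>
        (\<lambda>i. if i \<in> ?A \<and> ?f a \<in> fst i \<and> ?f b \<in> fst i then 1 * t l a i else 0) = t l b"
      proof (intro allI impI ext)
        fix a b i assume ab: "(a, b) \<in> ?Q"
        then have "act (R \<xi> I ?N) a b 1 (s a) = s b" using s by (simp add: is_section_def)
        from fun_cong[OF this[unfolded rs], of i]
        show "(if i \<in> ?A \<and> ?f a \<in> fst i \<and> ?f b \<in> fst i then 1 * t l a i else 0) = t l b i"
          by (cases "i = l") (auto simp: t_def unit_fun_def)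
      qed
    qed
    have lin: "linear_between (\<lambda>a u l. a * u l) (*) (obj (R \<xi> I ?N) a) UNIV (\<phi> a)"
      if "a \<in> Field ?Q" for a
      using \<phi> that by (simp add: is_cosection_def rs)
    have outside: "\<phi> q (t l q) = 0" if l: "l \<in> ?A - ?B" for l
    proof -
      \<comment> \<open>Otherwise \<open>fst l\<close> contains all minimal and maximal elements of
        \<open>I\<close>, hence \<open>I\<close> itself by convexity. At a point mapped outside
        \<open>fst l\<close> the component \<open>t l\<close> is zero, so its pairing vanishes
        everywhere.\<close>
      have "\<exists>a\<in>Field ?Q. ?f a \<notin> fst l"
      proof (rule ccontr)
        assume "\<not> (\<exists>a\<in>Field ?Q. ?f a \<notin> fst l)"
        then have b: "sc P I \<subseteq> fst l" "sk P I \<subseteq> fst l" using c(6) by blast+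
        have "convex_in P (fst l)" using intervalD(4)[OF P] l by (simp add: summands_def)
        then have "I \<subseteq> fst l"
          using sc_below[OF P intervalD(1)[OF P I]] sk_above[OF P intervalD(1)[OF P I]] b
          unfolding convex_in_def by blast
        then show False using l by blast
      qed
      then obtain a where a: "a \<in> Field ?Q" "?f a \<notin> fst l" by blast
      have "\<phi> q (t l q) = \<phi> a (t l a)" by (rule pairing_constant[OF c(3) t \<phi> q a(1)])
      also have "t l a = 0"
      proof -
        have "s a l = 0" using sm[OF a(1)] a(2) by blast
        then show ?thesis by (simp add: t_def fun_eq_iff)
      qed
      also have "\<phi> a 0 = 0" by (rule linear_between_zero[OF lin[OF a(1)] mod_zero_mem[OF N a(1)]])
      finally show ?thesis .
    qed
    have "s q = (\<Sum>l\<in>?A. t l q)"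
      unfolding t_def using sum_unit_fun[OF fin, of "s q"] sm[OF q] by metis
    then have "\<phi> q (s q) = \<phi> q (\<Sum>l\<in>?A. t l q)" by simp
    also have "\<dots> = (\<Sum>l\<in>?A. \<phi> q (t l q))"
    proof (rule linear_between_sum[OF lin[OF q]])
      show "vector_space (\<lambda>(a::'k) (u :: 'p set \<times> nat \<Rightarrow> 'k) l. a * u l)"
        using mod_vector_space[OF N] by (simp add: rs)
      show "module.subspace (\<lambda>(a::'k) u l. a * u l) (obj (R \<xi> I ?N) q)"
        using mod_subspace[OF N q] by (simp only: rs(1,4))
      show "t l q \<in> obj (R \<xi> I ?N) q" for l using t q unfolding is_section_def by blast
    qed
    also have "\<dots> = (\<Sum>l\<in>?B. \<phi> q (t l q))"
      by (rule sum.mono_neutral_right[OF fin]) (use outside in auto)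
    also have "\<dots> = (\<Sum>l\<in>?B. \<phi> q (unit_fun l) * s q l)"
    proof (rule sum.cong[OF refl])
      fix l assume l: "l \<in> ?B"
      then have "unit_fun l \<in> obj (R \<xi> I ?N) q"
        using fI[OF q] by (auto simp: rs unit_fun_def)
      from linear_between_scl[OF lin[OF q] this, of "s q l"]
      show "\<phi> q (t l q) = \<phi> q (unit_fun l) * s q l" by (simp add: t_def)
    qed
    finally show "\<phi> q (s q) = (\<Sum>l\<in>?B. \<phi> q (unit_fun l) * s q l)" .
  qed
  from comp_rank_eq_card[OF P \<xi> I interval_sum_is_mod[OF P] this] show ?thesis .
qed

lemma card_summands_above:
  assumes P: "finite_poset P"
  shows "card {l \<in> summands P m. I \<subseteq> fst l} = (\<Sum>K\<in>{K\<in>intervals P. I \<subseteq> K}. nat (m K))"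
proof -
  have "{l \<in> summands P m. I \<subseteq> fst l} = (SIGMA K:{K\<in>intervals P. I \<subseteq> K}. {..<nat (m K)})"
    by (auto simp: summands_def)
  then show ?thesis using finite_intervals[OF P] by simp
qed

theorem theorem4p14:
  fixes P :: "'p rel"
    and \<xi> :: "('p, 'q) compression"
    and M :: "('p, 'k::field, 'v::ab_group_add) rep"
  assumes "finite_poset P"
    and "rank_compression_system P \<xi>"
    and "is_mod P M"
  shows "(\<forall>I\<in>intervals P. virt_comp_rank \<xi> I (delta P \<xi> M) = int (comp_rank \<xi> I M)) \<and>
    (\<forall>x y. (x, y) \<in> P \<longrightarrow>
       virt_comp_rank \<xi> (segment P x y) (delta P \<xi> M) = int (seg_rank M x y)) \<and>
    (\<forall>x\<in>Field P. virt_dim (delta P \<xi> M) x = int (mod_dim M x))"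
proof -
  note P = assms(1) and \<xi> = assms(2) and M = assms(3)
  have rank: "virt_comp_rank \<xi> I (delta P \<xi> M) = int (comp_rank \<xi> I M)" if I: "I \<in> intervals P" for I
  proof -
    have "virt_comp_rank \<xi> I (delta P \<xi> M) =
        (\<Sum>K\<in>{K\<in>intervals P. I \<subseteq> K}. int (nat (delta_mult P \<xi> M K)) - int (nat (- delta_mult P \<xi> M K)))"
      by (simp add: virt_comp_rank_def delta_def comp_rank_interval_sum[OF P \<xi> I]
          card_summands_above[OF P] sum_subtractf)
    \<comment> \<open>At each \<open>K\<close> at most one of the two parts has a nonzero
      multiplicity, and their difference is the signed one.\<close>
    also have "\<dots> = (\<Sum>K\<in>{K\<in>intervals P. I \<subseteq> K}. delta_mult P \<xi> M K)"
      by (rule sum.cong) simp_all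
    also have "\<dots> = int (comp_rank \<xi> I M)"
      by (rule cover_join_inversion[OF P I]) (rule delta_mult_def)
    finally show ?thesis .
  qed
  have seg: "virt_comp_rank \<xi> (segment P x y) (delta P \<xi> M) = int (seg_rank M x y)" if "(x, y) \<in> P" for x y
    using rank[OF segment_interval[OF P that]] comp_rank_segment[OF P \<xi> M that] by simp
  have dim: "virt_dim (delta P \<xi> M) x = int (mod_dim M x)" if x: "x \<in> Field P" for x
  proof -
    have xx: "(x, x) \<in> P" by (rule poset_refl[OF P x])
    \<comment> \<open>Both parts are modules, so the rank of each at the segment from
      \<open>x\<close> to \<open>x\<close> is its dimension at \<open>x\<close>.\<close>
    have "virt_dim (delta P \<xi> M) x = virt_comp_rank \<xi> (segment P x x) (delta P \<xi> M)"
      by (simp add: virt_dim_def virt_comp_rank_def delta_def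
          comp_rank_segment[OF P \<xi> interval_sum_is_mod[OF P] xx]
          mod_dim_eq_seg_rank[OF interval_sum_is_mod[OF P] x])
    then show ?thesis using seg[OF xx] mod_dim_eq_seg_rank[OF M x] by simp
  qed
  show ?thesis using rank seg dim by blast
qed

end
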